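(* Let $s,t\ge1$, $n>s+t$ and $N=n+2s+t$. Let $\beta_{1,3}(s,t,n)$ be the number of continuous multiline queues of type $(s,t,n-s-t)$ with the largest entry $N$ in the last row and exactly one wrapping from the second row to the third row, whose projected word $\omega$ has $\omega_1=1$ and $\omega_2=3$. Then $$\beta_{1,3}(s,t,n)=\binom{N-1}{s-2}f_{(n-1,s+t)}.$$
   Context: A continuous multiline queue of type $(s,t,n-s-t)$ is a three-row array whose rows are strictly increasing sequences $a_1<\cdots<a_s$, $b_1<\cdots<b_{s+t}$, $c_1<\cdots<c_n$, whose $N$ entries are exactly $1,\ldots,N$, each once. Bully path procedure: initially all entries are available. First, each entry of row 1 starts a bully path; then each still-available entry of row 2 starts a bully path. An entry $x$ on a path bullies the smallest available entry of the next row larger than $x$, or, if there is none, the smallest available entry of the next row (a wrapping from that row to the next); bullied entries become unavailable and the path continues to row 3. Endpoints of paths starting in row 1 get label 1, those starting in row 2 get label 2, remaining entries of row 3 get label 3. The projected word is $\omega=(\omega_1,\ldots,\omega_n)$, $\omega_k$ the label of $c_k$. $f_{(a,b)}$ is the number of standard Young tableaux of shape $(a,b)$, equal to $\frac{a-b+1}{a+1}\binom{a+b}{a}$ for $a\ge b\ge0$. Binomial coefficients $\binom{x}{k}$ with $k<0$ are $0$. *)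

theory Defs
  imports Complex_Main
begin

definition is_cmlq :: "nat \<Rightarrow> nat \<Rightarrow> nat \<Rightarrow> nat list \<times> nat list \<times> nat list \<Rightarrow> bool" where
  "is_cmlq s t u = (\<lambda>(as, bs, cs).
     length as = s \<and> length bs = s + t \<and> length cs = s + t + u \<and>
     sorted_wrt (<) as \<and> sorted_wrt (<) bs \<and> sorted_wrt (<) cs \<and>
     distinct (as @ bs @ cs) \<and>
     set (as @ bs @ cs) = {1..length as + length bs + length cs})"

definition bullied :: "nat \<Rightarrow> nat set \<Rightarrow> nat" where
  "bullied x A = (if \<exists>y\<in>A. x < y then Min {y \<in> A. x < y} else Min A)"

text \<open>
  In the next two functions the list holds the entries of one row in the order in which their
  paths reach it, and the set holds the available entries of the next row. Since the available
  entries of different rows do not interact, following the paths one at a time is the same as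
  treating all transitions between two consecutive rows before going on to the next row.
\<close>

fun bully_targets :: "nat list \<Rightarrow> nat set \<Rightarrow> nat list" where
  "bully_targets [] A = []"
| "bully_targets (x # xs) A = bullied x A # bully_targets xs (A - {bullied x A})"

fun num_wrappings :: "nat list \<Rightarrow> nat set \<Rightarrow> nat" where
  "num_wrappings [] A = 0"
| "num_wrappings (x # xs) A =
     (if \<exists>y\<in>A. x < y then 0 else 1) + num_wrappings xs (A - {bullied x A})"

text \<open>
  Paths starting in the same row are followed in increasing order of their starting entries.
\<close>

definition row2_first :: "nat list \<times> nat list \<times> nat list \<Rightarrow> nat list" where
  "row2_first = (\<lambda>(as, bs, cs). bully_targets as (set bs))"

definition row2_second :: "nat list \<times> nat list \<times> nat list \<Rightarrow> nat list" where
  "row2_second = (\<lambda>(as, bs, cs). filter (\<lambda>b. b \<notin> set (row2_first (as, bs, cs))) bs)"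

definition endpoints1 :: "nat list \<times> nat list \<times> nat list \<Rightarrow> nat set" where
  "endpoints1 = (\<lambda>(as, bs, cs). set (bully_targets (row2_first (as, bs, cs)) (set cs)))"

definition endpoints2 :: "nat list \<times> nat list \<times> nat list \<Rightarrow> nat set" where
  "endpoints2 = (\<lambda>(as, bs, cs).
     set (bully_targets (row2_second (as, bs, cs)) (set cs - endpoints1 (as, bs, cs))))"

definition wrappings23 :: "nat list \<times> nat list \<times> nat list \<Rightarrow> nat" where
  "wrappings23 = (\<lambda>(as, bs, cs).
     num_wrappings (row2_first (as, bs, cs)) (set cs) +
     num_wrappings (row2_second (as, bs, cs)) (set cs - endpoints1 (as, bs, cs)))"

definition projected_word :: "nat list \<times> nat list \<times> nat list \<Rightarrow> nat list" where
  "projected_word = (\<lambda>(as, bs, cs).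
     map (\<lambda>c. if c \<in> endpoints1 (as, bs, cs) then 1
              else if c \<in> endpoints2 (as, bs, cs) then 2 else 3) cs)"

text \<open>The word is indexed from 0, so its first two letters are at positions 0 and 1.\<close>

definition beta13 :: "nat \<Rightarrow> nat \<Rightarrow> nat \<Rightarrow> nat" where
  "beta13 s t n = card {(as, bs, cs).
     is_cmlq s t (n - s - t) (as, bs, cs) \<and>
     n + 2 * s + t \<in> set cs \<and>
     wrappings23 (as, bs, cs) = 1 \<and>
     projected_word (as, bs, cs) ! 0 = 1 \<and>
     projected_word (as, bs, cs) ! 1 = 3}"

text \<open>A tableau is the list of its rows; the shape is assumed to be a partition.\<close>

definition is_SYT :: "nat list \<Rightarrow> nat list list \<Rightarrow> bool" where
  "is_SYT sh T \<longleftrightarrow>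
     map length T = sh \<and>
     (\<forall>r\<in>set T. sorted_wrt (<) r) \<and>
     (\<forall>i j. Suc i < length T \<and> j < length (T ! Suc i) \<longrightarrow> T ! i ! j < T ! Suc i ! j) \<and>
     distinct (concat T) \<and> set (concat T) = {1..sum_list sh}"

definition num_SYT :: "nat list \<Rightarrow> nat" where
  "num_SYT sh = card {T. is_SYT sh T}"

definition binom :: "nat \<Rightarrow> int \<Rightarrow> nat" where
  "binom x k = (if k < 0 then 0 else x choose nat k)"

end

theory Submission
  imports Defs
begin

text \<open>
  Read a queue as a word in the letters a, b, c (the row of each entry). Matching b's with later
  c's like brackets, the number of wrappings from row 2 to row 3 is the number of unmatched b's, and
  matching a's with later b's tells which entries of row 2 are bullied from row 1. The condition on
  the word then says: two c's precede all b's, exactly one b is unmatched, and all b's from it on are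
  matched with an a. Deleting the final c turns the one unmatched b into two. Now turn the leftmost
  unmatched b into c and then the leftmost a left unmatched into b (a product of two crystal
  operators): this is a bijection which lowers the number of unmatched b's and the number of a's by
  one. After two steps the a's are in arbitrary position, and the b's and c's form two c's followed
  by a reversed ballot sequence, that is, by a standard tableau with two rows.
\<close>

text \<open>Unmatched letters are recorded by extrema of two counting walks. The number of wrappings
  is the maximum of \<open>excess B C\<close>, which depends only on the sets and not on the order
  in which the paths are followed. "Every b from here on is matched with an a" becomes a comparison
  of values of \<open>lead A B\<close>. Turning a b into c alone would shrink row 2. Coupling it
  with the change of an a into b keeps the number \<open>s + t\<close> of b's, so one step changes
  only the level, the number of a's and the number of c's. Deleting the final c \<open>N\<close>
  raises the level from 1 to 2, so exactly two steps are available and \<open>s - 2\<close> letters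
  a remain in a word of length \<open>N - 1\<close>. The c's number \<open>n - 1\<close> after the
  deletion and \<open>n + 1\<close> after the steps. Two of them are the forced initial ones, which
  leaves \<open>n - 1\<close> for the first row of the tableau. At level 0 the condition linking a's
  to b's can be met at the cut behind the whole word, where it is vacuous; hence the a's become free
  and the count factors. If \<open>s = 1\<close>, the a's run out after one step and both sides
  vanish.\<close>

section \<open>Counting walks of two sets\<close>

definition lead :: "nat set \<Rightarrow> nat set \<Rightarrow> nat \<Rightarrow> int" where
  "lead X Y z = int (card (X \<inter> {..<z})) - int (card (Y \<inter> {..<z}))"

text \<open>Both walks are read at the cut just in front of \<open>z\<close>, \<open>lead\<close>
  from the left and \<open>excess\<close> from the right. The cut just behind an entry
  \<open>x\<close> is therefore \<open>Suc x\<close>.\<close>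

definition excess :: "nat set \<Rightarrow> nat set \<Rightarrow> nat \<Rightarrow> int" where
  "excess X Y z = int (card (X \<inter> {z..})) - int (card (Y \<inter> {z..}))"

lemma card_insert_Int:
  assumes "finite X" "a \<notin> X"
  shows "card (insert a X \<inter> S) = card (X \<inter> S) + of_bool (a \<in> S)"
  using assms by (cases "a \<in> S") auto

lemma card_remove_Int:
  assumes "finite X" "a \<in> X"
  shows "int (card ((X - {a}) \<inter> S)) = int (card (X \<inter> S)) - of_bool (a \<in> S)"
proof -
  have "X = insert a (X - {a})" using assms by auto
  then have "card (X \<inter> S) = card ((X - {a}) \<inter> S) + of_bool (a \<in> S)"
    using card_insert_Int[of "X - {a}" a S] assms by simp
  then show ?thesis by simp
qed

lemma lead_0 [simp]: "lead X Y 0 = 0"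
  by (simp add: lead_def)

lemma lead_Suc:
  assumes "X \<inter> Y = {}"
  shows "lead X Y (Suc z) = lead X Y z + of_bool (z \<in> X) - of_bool (z \<in> Y)"
proof -
  have "Z \<inter> {..<Suc z} = (if z \<in> Z then insert z (Z \<inter> {..<z}) else Z \<inter> {..<z})" for Z
    by (auto simp: less_Suc_eq)
  then have "card (Z \<inter> {..<Suc z}) = card (Z \<inter> {..<z}) + of_bool (z \<in> Z)" for Z by auto
  then show ?thesis by (simp add: lead_def)
qed

lemma excess_Suc:
  assumes "finite X" "finite Y"
  shows "excess X Y z = excess X Y (Suc z) + of_bool (z \<in> X) - of_bool (z \<in> Y)"
proof -
  have "Z \<inter> {z..} = (if z \<in> Z then insert z (Z \<inter> {Suc z..}) else Z \<inter> {Suc z..})" for Z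
    by (auto simp: Suc_le_eq le_less)
  then have "card (Z \<inter> {z..}) = card (Z \<inter> {Suc z..}) + of_bool (z \<in> Z)" if "finite Z" for Z
    using that by auto
  then show ?thesis using assms by (simp add: excess_def)
qed

lemma lead_eventually:
  assumes "X \<subseteq> {..<l}" "Y \<subseteq> {..<l}" "l \<le> z"
  shows "lead X Y z = int (card X) - int (card Y)"
proof -
  have "X \<inter> {..<z} = X" "Y \<inter> {..<z} = Y" using assms by fastforce+
  then show ?thesis by (simp add: lead_def)
qed

lemma excess_eventually:
  assumes "X \<subseteq> {..<l}" "Y \<subseteq> {..<l}" "l \<le> z"
  shows "excess X Y z = 0"
proof -
  have "X \<inter> {z..} = {}" "Y \<inter> {z..} = {}" using assms by fastforce+
  then show ?thesis by (simp add: excess_def)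
qed

section \<open>Queues as triples of sets, with marked positions\<close>

text \<open>
  If \<^term>\<open>A\<close> has fewer elements than \<^term>\<open>B\<close>, this says that every element of \<^term>\<open>B\<close> from
  \<^term>\<open>z\<close> on is matched with an earlier element of \<^term>\<open>A\<close>.
\<close>

definition covered :: "nat set \<Rightarrow> nat set \<Rightarrow> nat \<Rightarrow> bool" where
  "covered A B z \<longleftrightarrow> (\<exists>u\<le>z. \<forall>v\<ge>z. lead A B u \<le> lead A B v)"

definition arrangement :: "nat \<Rightarrow> nat \<Rightarrow> nat \<Rightarrow> nat set \<Rightarrow> nat set \<Rightarrow> nat set \<Rightarrow> bool" where
  "arrangement l s m A B C \<longleftrightarrow>
     A \<union> B \<union> C = {1..l} \<and> A \<inter> B = {} \<and> A \<inter> C = {} \<and> B \<inter> C = {} \<and>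
     card A = s \<and> card B = m \<and> (\<forall>b\<in>B. 2 \<le> card (C \<inter> {..<b}))"

text \<open>The level \<open>k\<close> is the maximum of the walk. \<open>covered\<close> passes to
  larger cuts, so asking for some maximiser is the same as asking for the last one whenever there is
  a last one, that is, for \<open>k \<ge> 1\<close>.\<close>

definition queues :: "int \<Rightarrow> nat \<Rightarrow> nat \<Rightarrow> nat \<Rightarrow> (nat set \<times> nat set \<times> nat set) set" where
  "queues k l s m = {(A, B, C). arrangement l s m A B C \<and> (\<forall>z. excess B C z \<le> k) \<and>
     (\<exists>z. excess B C z = k \<and> covered A B z)}"

text \<open>
  Here \<^term>\<open>p\<close> is the leftmost element of \<^term>\<open>B\<close> not matched with a later element of \<^term>\<open>C\<close>, and
  \<^term>\<open>a\<close> is the leftmost element of \<^term>\<open>A\<close> that is unmatched once \<^term>\<open>p\<close> is removed from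
  \<^term>\<open>B\<close>. The next definition describes the same two positions after the move.
\<close>

definition descent_mark :: "int \<Rightarrow> nat set \<Rightarrow> nat set \<Rightarrow> nat set \<Rightarrow> nat \<Rightarrow> nat \<Rightarrow> bool" where
  "descent_mark k A B C a p \<longleftrightarrow> a \<in> A \<and> p \<in> B \<and> a < p \<and>
     excess B C p = k \<and> (\<forall>z>p. excess B C z < k) \<and>
     (\<forall>v. lead A B a \<le> lead A B v) \<and> (\<forall>v. a < v \<and> v \<le> p \<longrightarrow> lead A B a < lead A B v)"

definition ascent_mark :: "int \<Rightarrow> nat set \<Rightarrow> nat set \<Rightarrow> nat set \<Rightarrow> nat \<Rightarrow> nat \<Rightarrow> bool" where
  "ascent_mark k A B C a p \<longleftrightarrow> a \<in> B \<and> p \<in> C \<and> a < p \<and>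
     excess B C (Suc p) = k \<and> (\<forall>z. a < z \<and> z \<le> p \<longrightarrow> excess B C z < k) \<and>
     (\<forall>v. lead A B (Suc a) \<le> lead A B v) \<and> (\<forall>v\<le>a. lead A B (Suc a) < lead A B v)"

section \<open>Uniqueness and existence of the marks\<close>

text \<open>Both marks are extremal: \<open>p\<close> is the last cut at level \<open>k\<close>, and
  \<open>a\<close> is the last minimiser of \<open>lead A B\<close> up to \<open>p\<close>.\<close>

lemma descent_mark_unique:
  assumes "descent_mark k A B C a p" "descent_mark k A B C a' p'"
  shows "a = a' \<and> p = p'"
proof -
  have "p = p'" using assms unfolding descent_mark_def by (metis less_irrefl nat_neq_iff)
  moreover have "a = a'"
    using assms \<open>p = p'\<close> unfolding descent_mark_def
    by (metis less_imp_le_nat not_le nat_neq_iff)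
  ultimately show ?thesis by simp
qed

text \<open>Here \<open>Suc a\<close> is the first global minimiser of \<open>lead A B\<close>, and
  \<open>Suc p\<close> is the first cut behind \<open>a\<close> at level \<open>k\<close>.\<close>

lemma ascent_mark_unique:
  assumes "ascent_mark k A B C a p" "ascent_mark k A B C a' p'"
  shows "a = a' \<and> p = p'"
proof -
  have a: "a = a'" using assms unfolding ascent_mark_def
    by (metis Suc_leI less_imp_le_nat not_le nat_neq_iff)
  moreover have "p = p'"
  proof (rule ccontr)
    assume "p \<noteq> p'"
    then consider "p < p'" | "p' < p" by linarith
    then show False using assms a unfolding ascent_mark_def
      by cases (metis Suc_leI less_irrefl less_Suc_eq)+
  qed
  ultimately show ?thesis by simp
qed

lemma covered_if_descent_mark:
  assumes "descent_mark k A B C a p"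
  shows "covered A B p"
  using assms unfolding descent_mark_def covered_def by (meson less_imp_le_nat)

lemma covered_if_ascent_mark:
  assumes "ascent_mark k A B C a p"
  shows "covered A B (Suc p)"
  using assms unfolding ascent_mark_def covered_def by (meson Suc_leI less_SucI)

lemma arrangementD:
  assumes "arrangement l s m A B C"
  shows "A \<subseteq> {..<Suc l}" "B \<subseteq> {..<Suc l}" "C \<subseteq> {..<Suc l}" "finite A" "finite B" "finite C"
    "A \<inter> B = {}" "B \<inter> C = {}" "A \<inter> C = {}" "card A = s" "card B = m"
proof -
  have "A \<union> B \<union> C \<subseteq> {..<Suc l}"
    using assms unfolding arrangement_def by (simp add: subset_eq)
  then show 1: "A \<subseteq> {..<Suc l}" "B \<subseteq> {..<Suc l}" "C \<subseteq> {..<Suc l}" by auto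
  show "A \<inter> B = {}" "B \<inter> C = {}" "A \<inter> C = {}" "card A = s" "card B = m"
    using assms unfolding arrangement_def by auto
  show "finite A" "finite B" "finite C"
    using 1 finite_subset by blast+
qed

text \<open>Behind the last maximum \<open>p\<close> the excess drops, so \<open>p\<close> is in
  \<open>B\<close>. Behind the last minimum \<open>a\<close> the lead rises, so \<open>a\<close> is
  in \<open>A\<close>; and \<open>a = p\<close> is impossible because the b at \<open>p\<close>
  would push the lead below its minimum.\<close>

lemma ex_descent_mark:
  assumes arr: "arrangement l s m A B C" and "k \<ge> 1"
    and le: "\<forall>z. excess B C z \<le> k" and ex: "\<exists>z. excess B C z = k \<and> covered A B z"
  shows "\<exists>a p. descent_mark k A B C a p"
proof -
  note sub = arrangementD[OF arr]
  obtain z where z: "excess B C z = k" "covered A B z" using ex by blast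
  \<comment> \<open>Beyond \<open>l\<close> the walk is 0, so a level \<open>k \<ge> 1\<close> is
    attained only finitely often and \<open>Max\<close> is meaningful.\<close>
  have bound: "y \<le> Suc l" if "excess B C y = k" for y
    using that excess_eventually[OF sub(2,3), of y] \<open>k \<ge> 1\<close> by fastforce
  define p where "p = Max {y. excess B C y = k}"
  have fin: "finite {y. excess B C y = k}"
    using bound by (meson finite_nat_set_iff_bounded_le mem_Collect_eq)
  have p: "excess B C p = k" and zp: "z \<le> p"
    unfolding p_def using Max_in[OF fin] Max_ge[OF fin] z by auto
  have above: "excess B C y < k" if "y > p" for y
    using that le Max_ge[OF fin, of y] unfolding p_def by (metis (mono_tags) leD mem_Collect_eq order_le_less)
  have pB: "p \<in> B"
  proof (rule ccontr)
    assume "p \<notin> B"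
    then have "excess B C p \<le> excess B C (Suc p)" using excess_Suc[OF sub(5,6), of p] by simp
    then show False using p above[of "Suc p"] by simp
  qed
  obtain u where u: "u \<le> z" "\<forall>v\<ge>z. lead A B u \<le> lead A B v"
    using z(2) unfolding covered_def by blast
  define S where "S = {y. y \<le> p \<and> (\<forall>v\<le>p. lead A B y \<le> lead A B v)}"
  have finS: "finite S" unfolding S_def by simp
  have "\<exists>y\<in>{..p}. \<forall>v\<in>{..p}. lead A B y \<le> lead A B v"
    using ex_min_if_finite[of "lead A B ` {..p}"] by (auto simp: not_less)
  then have "S \<noteq> {}" unfolding S_def by auto
  define a where "a = Max S"
  have aS: "a \<in> S" using Max_in[OF finS \<open>S \<noteq> {}\<close>] by (simp add: a_def)
  \<comment> \<open>The minimum was taken over cuts up to \<open>p\<close> only; behind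
    \<open>p\<close> the witness \<open>u\<close> of \<open>covered\<close> takes over.\<close>
  have min: "lead A B a \<le> lead A B v" for v
  proof (cases "v \<le> p")
    case True then show ?thesis using aS by (simp add: S_def)
  next
    case False
    then have "lead A B u \<le> lead A B v" using u zp by simp
    moreover have "lead A B a \<le> lead A B u" using aS u zp by (simp add: S_def)
    ultimately show ?thesis by simp
  qed
  have strict: "lead A B a < lead A B v" if "a < v" "v \<le> p" for v
  proof (rule ccontr)
    assume "\<not> ?thesis"
    then have "v \<in> S" using that min unfolding S_def by (smt (verit) mem_Collect_eq)
    then show False using Max_ge[OF finS] that by (simp add: a_def leD)
  qed
  have "a \<noteq> p"
  proof
    assume "a = p"
    then have "lead A B (Suc p) < lead A B a"
      using lead_Suc[OF sub(7), of p] pB sub(7) by auto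
    then show False using min[of "Suc p"] by simp
  qed
  then have ap: "a < p" using aS unfolding S_def by simp
  have "a \<in> A"
  proof (rule ccontr)
    assume "a \<notin> A"
    then have "lead A B (Suc a) \<le> lead A B a" using lead_Suc[OF sub(7), of a] by simp
    then show False using strict[of "Suc a"] ap by simp
  qed
  then show ?thesis unfolding descent_mark_def using ap pB p above min strict by blast
qed

text \<open>The lead falls into its first global minimum \<open>Suc a\<close>, so \<open>a\<close>
  is in \<open>B\<close>. This b makes the excess at \<open>Suc a\<close> smaller than at
  \<open>a\<close>, hence below \<open>k\<close>, so the next return to \<open>k\<close> happens
  strictly later and is a rise, caused by a c at \<open>p\<close>.\<close>

lemma ex_ascent_mark:
  assumes arr: "arrangement l s m A B C" and "s < m"
    and le: "\<forall>z. excess B C z \<le> k" and ex: "\<exists>z. excess B C z = k \<and> covered A B z"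
  shows "\<exists>a p. ascent_mark k A B C a p"
proof -
  note sub = arrangementD[OF arr]
  obtain z where z: "excess B C z = k" "covered A B z" using ex by blast
  obtain u where u: "u \<le> z" "\<forall>v\<ge>z. lead A B u \<le> lead A B v"
    using z(2) unfolding covered_def by blast
  have "\<exists>y\<in>{..z}. \<forall>v\<in>{..z}. lead A B y \<le> lead A B v"
    using ex_min_if_finite[of "lead A B ` {..z}"] by (auto simp: not_less)
  then obtain y where y: "y \<le> z" "\<forall>v\<le>z. lead A B y \<le> lead A B v" by auto
  have gy: "\<forall>v. lead A B y \<le> lead A B v"
    using y u by (meson le_trans nat_le_linear order_trans)
  define q where "q = (LEAST y. \<forall>v. lead A B y \<le> lead A B v)"
  have q: "lead A B q \<le> lead A B v" for v
    using LeastI[of "\<lambda>y. \<forall>v. lead A B y \<le> lead A B v", OF gy] by (simp add: q_def)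
  have qz: "q \<le> z" using Least_le[of "\<lambda>y. \<forall>v. lead A B y \<le> lead A B v", OF gy] y by (simp add: q_def)
  have qlt: "lead A B q < lead A B v" if "v < q" for v
    using not_less_Least[of v "\<lambda>y. \<forall>v. lead A B y \<le> lead A B v"] that q
    unfolding q_def[symmetric] by (meson linorder_not_le order_trans)
  \<comment> \<open>The walk starts at 0 and ends at \<open>s - m < 0\<close>, so its minimiser is
    not the initial cut and has a predecessor \<open>a\<close>.\<close>
  have "lead A B (Suc l) < 0"
    using lead_eventually[OF sub(1,2), of "Suc l"] \<open>s < m\<close> sub(10,11) by simp
  then have "lead A B q < 0" using q[of "Suc l"] by simp
  then have "q \<noteq> 0" by (metis lead_0 less_irrefl)
  then obtain a where a: "q = Suc a" by (meson not0_implies_Suc)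
  have aB: "a \<in> B"
  proof (rule ccontr)
    assume "a \<notin> B"
    then have "lead A B a \<le> lead A B q" using lead_Suc[OF sub(7), of a] a by simp
    then show False using qlt[of a] a by simp
  qed
  have "excess B C a = excess B C (Suc a) + 1"
    using excess_Suc[OF sub(5,6), of a] aB sub(8) by auto
  then have Suca: "excess B C (Suc a) < k" using le by (metis zless_add1_eq order_le_less not_less)
  define r where "r = (LEAST z. a < z \<and> excess B C z = k)"
  have ex: "a < z \<and> excess B C z = k" using z a qz by simp
  have r: "a < r" "excess B C r = k"
    using LeastI[of "\<lambda>z. a < z \<and> excess B C z = k", OF ex] by (simp_all add: r_def)
  have rlt: "excess B C y < k" if "a < y" "y < r" for y
    using not_less_Least[of y "\<lambda>z. a < z \<and> excess B C z = k"] that le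
    unfolding r_def[symmetric] by (metis order_le_less)
  have "r \<noteq> Suc a" using Suca r by auto
  then obtain p where p: "r = Suc p" "a < p" using r(1) by (metis Suc_lessE Suc_lessI)
  have "p \<in> C"
  proof (rule ccontr)
    assume "p \<notin> C"
    then have "excess B C (Suc p) \<le> excess B C p" using excess_Suc[OF sub(5,6), of p] by simp
    then show False using rlt[of p] p r by simp
  qed
  then show ?thesis unfolding ascent_mark_def using aB p r rlt q qlt a by (metis less_Suc_eq_le)
qed

section \<open>The move, its inverse, and the resulting equality of cardinalities\<close>

lemma excess_shift:
  assumes "finite B" "finite C" "a \<notin> B" "p \<in> B" "p \<notin> C"
  shows "excess (insert a (B - {p})) (insert p C) z =
    excess B C z + of_bool (z \<le> a) - 2 * of_bool (z \<le> p)"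
  using assms card_insert_Int[of "B - {p}" a "{z..}"] card_remove_Int[of B p "{z..}"]
    card_insert_Int[of C p "{z..}"]
  by (simp add: excess_def)

lemma lead_shift:
  assumes "finite A" "finite B" "a \<in> A" "a \<notin> B" "p \<in> B"
  shows "lead (A - {a}) (insert a (B - {p})) z =
    lead A B z + of_bool (p < z) - 2 * of_bool (a < z)"
  using assms card_insert_Int[of "B - {p}" a "{..<z}"] card_remove_Int[of B p "{..<z}"]
    card_remove_Int[of A a "{..<z}"]
  by (simp add: lead_def)

text \<open>The excess drops by 1 up to \<open>a\<close> and by 2 between \<open>a\<close> and
  \<open>p\<close>, and behind \<open>p\<close> it was below \<open>k\<close> already. The lead
  drops by 2 between \<open>a\<close> and \<open>p\<close>, where it exceeded its minimum, and by 1
  behind \<open>p\<close>. So the new minimum is one lower and is first reached at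
  \<open>Suc a\<close>, just behind the new b.\<close>

lemma descent_mark_shift:
  assumes arr: "arrangement l s m A B C" and mark: "descent_mark k A B C a p"
    and le: "\<forall>z. excess B C z \<le> k"
  defines "A' \<equiv> A - {a}" and "B' \<equiv> insert a (B - {p})" and "C' \<equiv> insert p C"
  shows "ascent_mark (k - 1) A' B' C' a p" "\<forall>z. excess B' C' z \<le> k - 1"
proof -
  note sub = arrangementD[OF arr]
  have mem: "a \<in> A" "p \<in> B" "a < p" "a \<notin> B" "p \<notin> C"
    using mark sub unfolding descent_mark_def by auto
  have g: "excess B' C' z = excess B C z + of_bool (z \<le> a) - 2 * of_bool (z \<le> p)" for z
    unfolding B'_def C'_def using mem sub by (intro excess_shift)
  have h: "lead A' B' z = lead A B z + of_bool (p < z) - 2 * of_bool (a < z)" for z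
    unfolding A'_def B'_def using mem sub by (intro lead_shift)
  have gp: "excess B C p = k" "\<And>z. z > p \<Longrightarrow> excess B C z < k"
    and ha: "\<And>v. lead A B a \<le> lead A B v" "\<And>v. a < v \<Longrightarrow> v \<le> p \<Longrightarrow> lead A B a < lead A B v"
    using mark unfolding descent_mark_def by auto
  have "excess B C p = excess B C (Suc p) + 1" using excess_Suc[OF sub(5,6), of p] mem by simp
  then have "excess B' C' (Suc p) = k - 1" using g[of "Suc p"] gp mem by simp
  moreover have "excess B' C' z < k - 1" if "a < z" "z \<le> p" for z
    using that g[of z] le[rule_format, of z] by simp
  moreover have hS: "lead A' B' (Suc a) = lead A B a - 1"
    using h[of "Suc a"] lead_Suc[OF sub(7), of a] mem by simp
  moreover have "lead A' B' (Suc a) < lead A' B' v" if "v \<le> a" for v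
    using hS h[of v] ha(1)[of v] that mem by simp
  moreover have "lead A' B' (Suc a) \<le> lead A' B' v" for v
    using hS h[of v] ha[of v] mem by (cases "v \<le> a"; cases "v \<le> p") auto
  moreover have "a \<in> B'" "p \<in> C'" unfolding B'_def C'_def by auto
  ultimately show "ascent_mark (k - 1) A' B' C' a p"
    unfolding ascent_mark_def using mem by blast
  show "\<forall>z. excess B' C' z \<le> k - 1"
  proof
    fix z show "excess B' C' z \<le> k - 1"
      using g[of z] gp(2)[of z] le[rule_format, of z] mem by (cases "z \<le> a"; cases "z \<le> p") auto
  qed
qed

text \<open>The walk identities of the move are read backwards, from the primed sets to the given
  ones. Between \<open>a\<close> and \<open>p\<close> the excess rises by 2, which the strict
  inequality in \<open>ascent_mark\<close> allows for.\<close>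

lemma ascent_mark_unshift:
  assumes arr: "arrangement l s m A B C" and mark: "ascent_mark k A B C a p"
    and le: "\<forall>z. excess B C z \<le> k"
  defines "A' \<equiv> insert a A" and "B' \<equiv> insert p (B - {a})" and "C' \<equiv> C - {p}"
  shows "descent_mark (k + 1) A' B' C' a p" "\<forall>z. excess B' C' z \<le> k + 1"
proof -
  note sub = arrangementD[OF arr]
  have mem: "a \<in> B" "p \<in> C" "a < p" "p \<notin> B" "a \<notin> A" "a \<notin> C" "p \<notin> A"
    using mark sub unfolding ascent_mark_def by auto
  have eqs: "insert a (B' - {p}) = B" "insert p C' = C" "A' - {a} = A"
    using mem by (auto simp: A'_def B'_def C'_def)
  have fin: "finite A'" "finite B'" "finite C'" using sub by (auto simp: A'_def B'_def C'_def)
  have mem': "a \<in> A'" "p \<in> B'" "a \<notin> B'" "p \<notin> C'"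
    using mem by (auto simp: A'_def B'_def C'_def)
  have g: "excess B C z = excess B' C' z + of_bool (z \<le> a) - 2 * of_bool (z \<le> p)" for z
    using excess_shift[of B' C' a p z] eqs fin mem' by simp
  have h: "lead A B z = lead A' B' z + of_bool (p < z) - 2 * of_bool (a < z)" for z
    using lead_shift[of A' B' a p z] eqs fin mem' by simp
  have gp: "excess B C (Suc p) = k" "\<And>z. a < z \<Longrightarrow> z \<le> p \<Longrightarrow> excess B C z < k"
    and ha: "\<And>v. lead A B (Suc a) \<le> lead A B v" "\<And>v. v \<le> a \<Longrightarrow> lead A B (Suc a) < lead A B v"
    using mark unfolding ascent_mark_def by auto
  have "excess B C p = excess B C (Suc p) - 1" using excess_Suc[OF sub(5,6), of p] mem by simp
  then have "excess B' C' p = k + 1" using g[of p] gp mem by simp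
  moreover have "excess B' C' z < k + 1" if "z > p" for z
    using that g[of z] le[rule_format, of z] mem by simp
  moreover have hS: "lead A' B' a = lead A B (Suc a) + 1"
    using h[of a] lead_Suc[OF sub(7), of a] mem by simp
  moreover have "lead A' B' a < lead A' B' v" if "a < v" "v \<le> p" for v
    using hS h[of v] ha(1)[of v] that by simp
  moreover have "lead A' B' a \<le> lead A' B' v" for v
    using hS h[of v] ha[of v] mem by (cases "v \<le> a"; cases "v \<le> p") auto
  ultimately show "descent_mark (k + 1) A' B' C' a p"
    unfolding descent_mark_def using mem mem' by blast
  show "\<forall>z. excess B' C' z \<le> k + 1"
  proof
    fix z show "excess B' C' z \<le> k + 1"
      using g[of z] gp(2)[of z] le[rule_format, of z] mem by (cases "z \<le> a"; cases "z \<le> p") auto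
  qed
qed

text \<open>Only the new b at \<open>a\<close> could lack two c's in front of it. The minimum of the
  lead is at most \<open>Suc s - m < 0\<close>, so some b already precedes \<open>a\<close>, and the
  two c's in front of that b serve \<open>a\<close> as well.\<close>

lemma arrangement_shift:
  assumes arr: "arrangement l (Suc s) m A B C" and mark: "descent_mark k A B C a p" and "Suc s < m"
  shows "arrangement l s m (A - {a}) (insert a (B - {p})) (insert p C)"
proof -
  note sub = arrangementD[OF arr]
  have mem: "a \<in> A" "p \<in> B" "a < p" "a \<notin> B" "p \<notin> C" "p \<notin> A" "a \<notin> C"
    using mark sub unfolding descent_mark_def by auto
  have "lead A B a \<le> lead A B (Suc l)" using mark unfolding descent_mark_def by blast
  also have "\<dots> < 0" using lead_eventually[OF sub(1,2), of "Suc l"] \<open>Suc s < m\<close> sub(10,11) by simp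
  finally have "card (B \<inter> {..<a}) > 0" unfolding lead_def by linarith
  then obtain b where b: "b \<in> B" "b < a" by (metis IntE card_gt_0_iff ex_in_conv lessThan_iff)
  have c: "2 \<le> card (C \<inter> {..<x})" if "x \<in> B" for x using arr that by (simp add: arrangement_def)
  have mono: "card (C \<inter> {..<x}) \<le> card (insert p C \<inter> {..<y})" if "x \<le> y" for x y
    using that sub by (intro card_mono) auto
  have "2 \<le> card (insert p C \<inter> {..<x})" if x: "x \<in> insert a (B - {p})" for x
    using x c[of x] c[OF b(1)] mono[of x x] mono[of b a] b(2) by fastforce
  moreover have "card (insert a (B - {p})) = m" "card (A - {a}) = s"
    using mem sub card_Suc_Diff1[of B p] by simp_all
  moreover have "A - {a} \<union> insert a (B - {p}) \<union> insert p C = {1..l}"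
    using mem arr unfolding arrangement_def by blast
  moreover have "(A - {a}) \<inter> insert a (B - {p}) = {}" "(A - {a}) \<inter> insert p C = {}"
    "insert a (B - {p}) \<inter> insert p C = {}" using sub(7-9) mem by blast+
  ultimately show ?thesis by (simp only: arrangement_def simp_thms) blast
qed

text \<open>Losing the c at \<open>p\<close> could harm only b's from \<open>p\<close> on. A further
  b in front of \<open>a < p\<close> exists because the lead at \<open>a\<close> is at most
  \<open>s - m + 1 < 0\<close>, and the two c's in front of it survive.\<close>

lemma arrangement_unshift:
  assumes arr: "arrangement l s m A B C" and mark: "ascent_mark k A B C a p" and "Suc s < m"
  shows "arrangement l (Suc s) m (insert a A) (insert p (B - {a})) (C - {p})"
proof -
  note sub = arrangementD[OF arr]
  have mem: "a \<in> B" "p \<in> C" "a < p" "p \<notin> B" "a \<notin> A" "a \<notin> C" "p \<notin> A"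
    using mark sub unfolding ascent_mark_def by auto
  have "lead A B a = lead A B (Suc a) + 1" using lead_Suc[OF sub(7), of a] mem by simp
  also have "lead A B (Suc a) \<le> lead A B (Suc l)" using mark unfolding ascent_mark_def by blast
  also have "lead A B (Suc l) + 1 < 0"
    using lead_eventually[OF sub(1,2), of "Suc l"] \<open>Suc s < m\<close> sub(10,11) by simp
  finally have "card (B \<inter> {..<a}) > 0" unfolding lead_def by linarith
  then obtain b where b: "b \<in> B" "b < a" by (metis IntE card_gt_0_iff ex_in_conv lessThan_iff)
  have c: "2 \<le> card (C \<inter> {..<x})" if "x \<in> B" for x using arr that by (simp add: arrangement_def)
  have mono: "card (C \<inter> {..<x}) \<le> card ((C - {p}) \<inter> {..<y})" if "x \<le> y" "x \<le> p" for x y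
    using that sub by (intro card_mono) auto
  have "2 \<le> card ((C - {p}) \<inter> {..<x})" if x: "x \<in> insert p (B - {a})" for x
  proof (cases "x \<le> b")
    case True
    then show ?thesis using x c[of x] mono[of x x] b mem by auto
  next
    case False
    then show ?thesis using c[OF b(1)] mono[of b x] b mem by linarith
  qed
  moreover have "card (insert p (B - {a})) = m" "card (insert a A) = Suc s"
    using mem sub card_Suc_Diff1[of B a] by simp_all
  moreover have "insert a A \<union> insert p (B - {a}) \<union> (C - {p}) = {1..l}"
    using mem arr unfolding arrangement_def by blast
  moreover have "insert a A \<inter> insert p (B - {a}) = {}" "insert a A \<inter> (C - {p}) = {}"
    "insert p (B - {a}) \<inter> (C - {p}) = {}" using sub(7-9) mem by auto
  ultimately show ?thesis by (simp only: arrangement_def simp_thms) blast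
qed

text \<open>The marks are carried along as extra components, which makes both directions of the
  bijection explicit formulas. Existence and uniqueness of the marks show that forgetting them loses
  nothing.\<close>

lemma card_queues_step:
  assumes "k \<ge> 1" "Suc s < m"
  shows "card (queues k l (Suc s) m) = card (queues (k - 1) l s m)"
proof -
  define X where "X = {(A, B, C, a, p). arrangement l (Suc s) m A B C \<and> (\<forall>z. excess B C z \<le> k) \<and>
    descent_mark k A B C a p}"
  define Y where "Y = {(A, B, C, a, p). arrangement l s m A B C \<and> (\<forall>z. excess B C z \<le> k - 1) \<and>
    ascent_mark (k - 1) A B C a p}"
  let ?forget = "\<lambda>(A, B, C, a, p). (A, B, C)"
  have "inj_on ?forget X" by (auto simp: inj_on_def X_def dest: descent_mark_unique)
  moreover have "?forget ` X = queues k l (Suc s) m"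
  proof (intro equalityI subsetI)
    fix x assume "x \<in> ?forget ` X"
    then obtain A B C a p where x: "x = (A, B, C)" "arrangement l (Suc s) m A B C"
      "\<forall>z. excess B C z \<le> k" and mark: "descent_mark k A B C a p" unfolding X_def by auto
    have "excess B C p = k" using mark by (simp add: descent_mark_def)
    then show "x \<in> queues k l (Suc s) m"
      using x covered_if_descent_mark[OF mark] unfolding queues_def by blast
  next
    fix x assume "x \<in> queues k l (Suc s) m"
    then obtain A B C where x: "x = (A, B, C)" "arrangement l (Suc s) m A B C" "\<forall>z. excess B C z \<le> k"
      "\<exists>z. excess B C z = k \<and> covered A B z" unfolding queues_def by blast
    then obtain a p where "descent_mark k A B C a p" using ex_descent_mark assms by blast
    then have "(A, B, C, a, p) \<in> X" using x unfolding X_def by blast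
    then show "x \<in> ?forget ` X" using x(1) by force
  qed
  ultimately have cX: "card X = card (queues k l (Suc s) m)" using card_image by fastforce
  have "inj_on ?forget Y" by (auto simp: inj_on_def Y_def dest: ascent_mark_unique)
  moreover have "?forget ` Y = queues (k - 1) l s m"
  proof (intro equalityI subsetI)
    fix x assume "x \<in> ?forget ` Y"
    then obtain A B C a p where x: "x = (A, B, C)" "arrangement l s m A B C"
      "\<forall>z. excess B C z \<le> k - 1" and mark: "ascent_mark (k - 1) A B C a p" unfolding Y_def by auto
    have "excess B C (Suc p) = k - 1" using mark by (simp add: ascent_mark_def)
    then show "x \<in> queues (k - 1) l s m"
      using x covered_if_ascent_mark[OF mark] unfolding queues_def by blast
  next
    fix x assume "x \<in> queues (k - 1) l s m"
    then obtain A B C where x: "x = (A, B, C)" "arrangement l s m A B C" "\<forall>z. excess B C z \<le> k - 1"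
      "\<exists>z. excess B C z = k - 1 \<and> covered A B z" unfolding queues_def by blast
    then obtain a p where "ascent_mark (k - 1) A B C a p" using ex_ascent_mark assms by (meson Suc_lessD)
    then have "(A, B, C, a, p) \<in> Y" using x unfolding Y_def by blast
    then show "x \<in> ?forget ` Y" using x(1) by force
  qed
  ultimately have cY: "card Y = card (queues (k - 1) l s m)" using card_image by fastforce
  define f :: "nat set \<times> nat set \<times> nat set \<times> nat \<times> nat \<Rightarrow> _" where
    "f = (\<lambda>(A, B, C, a, p). (A - {a}, insert a (B - {p}), insert p C, a, p))"
  define g :: "nat set \<times> nat set \<times> nat set \<times> nat \<times> nat \<Rightarrow> _" where
    "g = (\<lambda>(A, B, C, a, p). (insert a A, insert p (B - {a}), C - {p}, a, p))"
  have X: "f x \<in> Y \<and> g (f x) = x" if "x \<in> X" for x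
  proof -
    obtain A B C a p where x: "x = (A, B, C, a, p)" by (cases x)
    have X: "arrangement l (Suc s) m A B C" "descent_mark k A B C a p" "\<forall>z. excess B C z \<le> k"
      using that unfolding X_def x by auto
    then have "a \<in> A" "p \<in> B" by (simp_all add: descent_mark_def)
    moreover have "a \<notin> B" "p \<notin> C" using arrangementD(7,8)[OF X(1)] calculation by blast+
    ultimately have "insert a (A - {a}) = A" "insert p (insert a (B - {p}) - {a}) = B"
      "insert p C - {p} = C" by auto
    then have "g (f x) = x" unfolding f_def g_def x by simp
    moreover have "f x \<in> Y" unfolding f_def x Y_def
      using arrangement_shift[OF X(1,2) assms(2)] descent_mark_shift[OF X] by simp
    ultimately show ?thesis by simp
  qed
  have Y: "g y \<in> X \<and> f (g y) = y" if "y \<in> Y" for y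
  proof -
    obtain A B C a p where y: "y = (A, B, C, a, p)" by (cases y)
    have Y: "arrangement l s m A B C" "ascent_mark (k - 1) A B C a p" "\<forall>z. excess B C z \<le> k - 1"
      using that unfolding Y_def y by auto
    then have "a \<in> B" "p \<in> C" by (simp_all add: ascent_mark_def)
    moreover have "a \<notin> A" "p \<notin> B" using arrangementD(7,8)[OF Y(1)] calculation by blast+
    ultimately have "insert a A - {a} = A" "insert a (insert p (B - {a}) - {p}) = B"
      "insert p (C - {p}) = C" by auto
    then have "f (g y) = y" unfolding f_def g_def y by simp
    moreover have "g y \<in> X" unfolding g_def y X_def
      using arrangement_unshift[OF Y(1,2) assms(2)] ascent_mark_unshift[OF Y] by simp
    ultimately show ?thesis by simp
  qed
  have "bij_betw f X Y" by (rule bij_betw_byWitness[where f' = g]) (use X Y in auto)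
  then show ?thesis using bij_betw_same_card cX cY by metis
qed

text \<open>Without a's the lead can only fall, at each b. So \<open>covered\<close> at
  \<open>z\<close> forbids b's from \<open>z\<close> on, whereas a positive excess at
  \<open>z\<close> requires one.\<close>

lemma queues_0_empty:
  assumes "k \<ge> 1"
  shows "queues k l 0 m = {}"
proof -
  have False if "(A, B, C) \<in> queues k l 0 m" for A B C
  proof -
    from that obtain z where arr: "arrangement l 0 m A B C" and z: "excess B C z = k" "covered A B z"
      unfolding queues_def by blast
    note sub = arrangementD[OF arr]
    have "A = {}" using sub by simp
    then obtain u where u: "u \<le> z" "\<forall>v\<ge>z. card (B \<inter> {..<v}) \<le> card (B \<inter> {..<u})"
      using z(2) unfolding covered_def lead_def by auto
    have "card (B \<inter> {z..}) > 0" using z(1) assms unfolding excess_def by linarith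
    then obtain b where b: "b \<in> B" "z \<le> b" by (metis IntE card_gt_0_iff ex_in_conv atLeast_iff)
    have "b \<in> B \<inter> {..<Suc b}" "b \<notin> B \<inter> {..<u}" "B \<inter> {..<u} \<subseteq> B \<inter> {..<Suc b}" using b u by auto
    then have "card (B \<inter> {..<u}) < card (B \<inter> {..<Suc b})"
      using sub(5) by (intro psubset_card_mono) blast+
    then show False using u(2) b by (meson le_SucI not_le)
  qed
  then show ?thesis by auto
qed

section \<open>Bully paths expressed by the walks\<close>

lemma bullied_above:
  assumes "finite Y" "\<exists>y\<in>Y. x < y"
  shows "bullied x Y \<in> Y" "x < bullied x Y" "\<And>y. y \<in> Y \<Longrightarrow> x < y \<Longrightarrow> bullied x Y \<le> y"
proof -
  have *: "finite {y \<in> Y. x < y}" "{y \<in> Y. x < y} \<noteq> {}" using assms by auto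
  have "bullied x Y = Min {y \<in> Y. x < y}" using assms by (simp add: bullied_def)
  then show "bullied x Y \<in> Y" "x < bullied x Y" "\<And>y. y \<in> Y \<Longrightarrow> x < y \<Longrightarrow> bullied x Y \<le> y"
    using Min_in[OF *] Min_le[OF *(1)] by auto
qed

lemma bullied_wrap:
  assumes "finite Y" "Y \<noteq> {}" "\<not> (\<exists>y\<in>Y. x < y)"
  shows "bullied x Y \<in> Y" "bullied x Y \<le> x" "\<And>y. y \<in> Y \<Longrightarrow> bullied x Y \<le> y"
proof -
  have "bullied x Y = Min Y" using assms by (simp add: bullied_def)
  then show "bullied x Y \<in> Y" "bullied x Y \<le> x" "\<And>y. y \<in> Y \<Longrightarrow> bullied x Y \<le> y"
    using assms by (auto simp: not_less)
qed

lemma bullied_in: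
  assumes "finite Y" "Y \<noteq> {}"
  shows "bullied x Y \<in> Y"
  using bullied_above(1)[OF assms(1)] bullied_wrap(1)[OF assms] by (cases "\<exists>y\<in>Y. x < y") simp_all

lemma set_bully_targets:
  assumes "finite Y" "length xs \<le> card Y"
  shows "set (bully_targets xs Y) \<subseteq> Y \<and> distinct (bully_targets xs Y)"
  using assms
proof (induction xs Y rule: bully_targets.induct)
  case (2 x xs Y)
  have "Y \<noteq> {}" using 2 by auto
  then have y: "bullied x Y \<in> Y" using 2 bullied_in by blast
  then have "length xs \<le> card (Y - {bullied x Y})" using 2 by simp
  then show ?case using 2 y by auto
qed simp

lemma length_bully_targets [simp]: "length (bully_targets xs Y) = length xs"
  by (induction xs Y rule: bully_targets.induct) simp_all

lemma bully_targets_append: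
  "bully_targets (xs @ ys) Y = bully_targets xs Y @ bully_targets ys (Y - set (bully_targets xs Y))"
proof (induction xs Y rule: bully_targets.induct)
  case (2 x xs Y)
  let ?T = "set (bully_targets xs (Y - {bullied x Y}))"
  have "Y - {bullied x Y} - ?T = Y - insert (bullied x Y) ?T" by blast
  with 2 show ?case by (simp only: bully_targets.simps append_Cons list.set)
qed simp

lemma num_wrappings_append:
  "num_wrappings (xs @ ys) Y = num_wrappings xs Y + num_wrappings ys (Y - set (bully_targets xs Y))"
proof (induction xs Y rule: bully_targets.induct)
  case (2 x xs Y)
  let ?T = "set (bully_targets xs (Y - {bullied x Y}))"
  have "Y - {bullied x Y} - ?T = Y - insert (bullied x Y) ?T" by blast
  with 2 show ?case
    by (simp only: bully_targets.simps num_wrappings.simps append_Cons list.set add.assoc)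
qed simp

lemma excess_remove2:
  assumes "finite X" "finite Y" "x \<notin> X" "y \<in> Y"
  shows "excess (insert x X) Y z = excess X (Y - {y}) z + of_bool (z \<le> x) - of_bool (z \<le> y)"
  using assms card_insert_Int[of X x "{z..}"] card_remove_Int[of Y y "{z..}"]
  by (simp add: excess_def)

lemma lead_remove2:
  assumes "finite X" "finite Y" "x \<notin> X" "y \<in> Y"
  shows "lead (insert x X) Y z = lead X (Y - {y}) z + of_bool (x < z) - of_bool (y < z)"
  using assms card_insert_Int[of X x "{..<z}"] card_remove_Int[of Y y "{..<z}"]
  by (simp add: lead_def)

text \<open>Restoring a pair \<open>x\<close>, \<open>y\<close> changes the excess only between the
  two. Without wrapping it drops by 1 on the cuts from behind \<open>x\<close> up to
  \<open>y\<close>, where it was not larger than at \<open>x\<close>, so the maximum stays. With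
  wrapping it rises by 1 from behind \<open>y\<close> up to \<open>x\<close>, an interval on which
  the maximum is attained. The criterion sees only \<open>set xs\<close>, so the two classes of
  paths can later be merged.\<close>

lemma num_wrappings_le_iff:
  assumes "finite Y" "distinct xs" "set xs \<inter> Y = {}" "length xs \<le> card Y"
  shows "num_wrappings xs Y \<le> k \<longleftrightarrow> (\<forall>z. excess (set xs) Y z \<le> int k)"
  using assms
proof (induction xs arbitrary: Y k)
  case Nil
  then show ?case by (simp add: excess_def)
next
  case (Cons x xs)
  define y where "y = bullied x Y"
  define Y' where "Y' = Y - {y}"
  have "Y \<noteq> {}" using Cons.prems by auto
  have y: "y \<in> Y" unfolding y_def using bullied_in Cons.prems(1) \<open>Y \<noteq> {}\<close> by blast
  have x: "x \<notin> set xs" "x \<notin> Y" "x \<noteq> y" using Cons.prems y by auto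
  have len: "length xs \<le> card Y'" using Cons.prems y by (simp add: Y'_def)
  have fin: "finite Y'" using Cons.prems by (simp add: Y'_def)
  have IH: "num_wrappings xs Y' \<le> k \<longleftrightarrow> (\<forall>z. excess (set xs) Y' z \<le> int k)" for k
    using Cons.prems len fin by (intro Cons.IH) (auto simp: Y'_def)
  have g: "excess (set (x # xs)) Y z = excess (set xs) Y' z + of_bool (z \<le> x) - of_bool (z \<le> y)" for z
    unfolding Y'_def using excess_remove2[of "set xs" Y x y z] Cons.prems(1) x y by simp
  show ?case
  proof (cases "\<exists>y\<in>Y. x < y")
    case True
    note b = bullied_above[OF Cons.prems(1) True, folded y_def]
    \<comment> \<open>No element of \<open>Y'\<close> lies between \<open>x\<close> and its target,
      so on this stretch moving the cut can only lose elements of \<open>xs\<close>.\<close>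
    have key: "excess (set xs) Y' z \<le> excess (set (x # xs)) Y x" if "x < z" "z \<le> y" for z
    proof -
      have "Y' \<inter> {z..} = Y' \<inter> {x..}" using b(3) x that by (force simp: Y'_def)
      moreover have "card (set xs \<inter> {z..}) \<le> card (set xs \<inter> {x..})"
        using that by (intro card_mono) auto
      ultimately show ?thesis using g[of x] b(2) by (simp add: excess_def)
    qed
    have "(\<forall>z. excess (set (x # xs)) Y z \<le> int k) \<longleftrightarrow> (\<forall>z. excess (set xs) Y' z \<le> int k)"
    proof (intro iffI allI)
      fix z assume *: "\<forall>z. excess (set (x # xs)) Y z \<le> int k"
      show "excess (set xs) Y' z \<le> int k"
        using key[of z] g[of z] *[rule_format, of x] *[rule_format, of z] b(2)
        by (cases "z \<le> x"; cases "z \<le> y") auto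
    next
      fix z assume *: "\<forall>z. excess (set xs) Y' z \<le> int k"
      show "excess (set (x # xs)) Y z \<le> int k"
        using g[of z] *[rule_format, of z] b(2) by (cases "z \<le> x"; cases "z \<le> y") auto
    qed
    then show ?thesis using True IH by (simp add: y_def Y'_def)
  next
    case False
    note b = bullied_wrap[OF Cons.prems(1) \<open>Y \<noteq> {}\<close> False, folded y_def]
    have yx: "y < x" using b x by simp
    have emp: "Y' \<inter> {z..} = {}" if "x \<le> z" for z
      using False that x(2) by (auto simp: Y'_def) (metis le_less le_trans)
    have pos: "excess (set (x # xs)) Y x \<ge> 1"
      using g[of x] emp[of x] yx by (simp add: excess_def)
    have nw: "num_wrappings (x # xs) Y = Suc (num_wrappings xs Y')"
      using False by (simp add: y_def Y'_def)
    show ?thesis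
    proof (cases k)
      case 0
      then show ?thesis using nw pos by (auto intro!: exI[of _ x])
    next
      case (Suc k')
      \<comment> \<open>Up to the least element \<open>y\<close> every remaining target is still
        counted, and there are at least as many targets as entries.\<close>
      have low: "excess (set xs) Y' z \<le> 0" if "z \<le> y" for z
      proof -
        have "Y' \<inter> {z..} = Y'" using b(3) that by (force simp: Y'_def)
        moreover have "card (set xs \<inter> {z..}) \<le> length xs"
          by (meson card_length card_mono inf_le1 le_trans List.finite_set)
        ultimately show ?thesis using len by (simp add: excess_def)
      qed
      have high: "excess (set xs) Y' z \<le> excess (set xs) Y' x" if "x \<le> z" for z
        using emp[of z] emp[of x] that by (auto simp: excess_def intro!: card_mono)
      have "(\<forall>z. excess (set (x # xs)) Y z \<le> int k) \<longleftrightarrow> (\<forall>z. excess (set xs) Y' z \<le> int k')"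
      proof (intro iffI allI)
        fix z assume *: "\<forall>z. excess (set (x # xs)) Y z \<le> int k"
        show "excess (set xs) Y' z \<le> int k'"
          using low[of z] high[of z] g[of z] g[of x] *[rule_format, of x] *[rule_format, of z] yx Suc
          by (cases "z \<le> x"; cases "z \<le> y") auto
      next
        fix z assume *: "\<forall>z. excess (set xs) Y' z \<le> int k'"
        show "excess (set (x # xs)) Y z \<le> int k"
          using g[of z] *[rule_format, of z] Suc yx by (cases "z \<le> x"; cases "z \<le> y") auto
      qed
      then show ?thesis using nw IH Suc by simp
    qed
  qed
qed

lemma prefix_min_bump:
  fixes h h' :: "nat \<Rightarrow> int"
  assumes h: "\<And>j. h j = h' j + of_bool (x < j \<and> j \<le> y)"
    and low: "\<And>j. x \<le> j \<Longrightarrow> j \<le> y \<Longrightarrow> h' x \<le> h' j"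
  shows "(\<exists>u\<le>z. \<forall>v\<ge>z. h u \<le> h v) \<longleftrightarrow> (\<exists>u\<le>z. \<forall>v\<ge>z. h' u \<le> h' v)"
proof
  assume "\<exists>u\<le>z. \<forall>v\<ge>z. h u \<le> h v"
  then obtain u where u: "u \<le> z" "\<And>v. v \<ge> z \<Longrightarrow> h u \<le> h v" by blast
  have hx: "h x = h' x" using h[of x] by simp
  \<comment> \<open>The witness moves to \<open>x\<close> when \<open>u\<close> lies in the raised
    stretch, and also when \<open>x\<close> is at least as low as \<open>u\<close>; the latter keeps
    it below every lowered value.\<close>
  define w where "w = (if x \<le> z \<and> (x < u \<and> u \<le> y \<or> h x \<le> h u) then x else u)"
  have "w \<le> z" using u by (simp add: w_def)
  have hw: "h' w \<le> h u"
    using h[of u] low[of u] hx by (auto simp: w_def)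
  have hwx: "h' w \<le> h x"
  proof (cases "x \<le> z")
    case True
    then show ?thesis using h[of u] hx by (auto simp: w_def)
  next
    case False
    then show ?thesis using u(2)[of x] hw by simp
  qed
  have "h' w \<le> h' v" if "v \<ge> z" for v
    using h[of v] low[of v] u(2)[OF that] hw hwx hx by (cases "x < v \<and> v \<le> y") auto
  then show "\<exists>u\<le>z. \<forall>v\<ge>z. h' u \<le> h' v" using \<open>w \<le> z\<close> by blast
next
  assume "\<exists>u\<le>z. \<forall>v\<ge>z. h' u \<le> h' v"
  then obtain u where u: "u \<le> z" "\<And>v. v \<ge> z \<Longrightarrow> h' u \<le> h' v" by blast
  define w where "w = (if x < u \<and> u \<le> y then x else u)"
  have "w \<le> z" using u by (simp add: w_def)
  have hw: "h w \<le> h' u" using h[of w] low[of u] by (auto simp: w_def)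
  have "h w \<le> h v" if "v \<ge> z" for v
    using h[of v] u(2)[OF that] hw by (cases "x < v \<and> v \<le> y") auto
  then show "\<exists>u\<le>z. \<forall>v\<ge>z. h u \<le> h v" using \<open>w \<le> z\<close> by blast
qed

text \<open>Effect on \<open>covered\<close> of a step that wraps. The walk is nonnegative up to
  \<open>y\<close> and finally negative, so for a cut \<open>z\<close> up to \<open>x\<close> any
  witness lies behind \<open>y\<close>, inside the stretch that changes. Behind \<open>x\<close> the
  walk exceeds its value at \<open>x\<close>, which compensates for the shift by 1. For
  \<open>z\<close> behind \<open>x\<close> monotonicity makes \<open>z\<close> itself a
  witness.\<close>

lemma prefix_min_dip:
  fixes h h' :: "nat \<Rightarrow> int"
  assumes h: "\<And>j. h' j = h j + of_bool (y < j \<and> j \<le> x)"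
    and nonneg: "\<And>j. j \<le> y \<Longrightarrow> 0 \<le> h j"
    and neg: "\<And>j. j \<ge> l \<Longrightarrow> h j < 0"
    and "y < x" "x < l"
    and up: "\<And>j. x < j \<Longrightarrow> h x < h j"
    and mono: "\<And>i j. x < i \<Longrightarrow> i \<le> j \<Longrightarrow> h i \<le> h j"
  shows "(\<exists>u\<le>z. \<forall>v\<ge>z. h u \<le> h v) \<longleftrightarrow> (\<exists>u\<le>z. \<forall>v\<ge>z. h' u \<le> h' v)"
proof (cases "x < z")
  case True
  then have "\<forall>v\<ge>z. h z \<le> h v" "\<forall>v\<ge>z. h' z \<le> h' v" using mono h by auto
  then show ?thesis by blast
next
  case False
  show ?thesis
  proof
    assume "\<exists>u\<le>z. \<forall>v\<ge>z. h u \<le> h v"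
    then obtain u where u: "u \<le> z" "\<And>v. v \<ge> z \<Longrightarrow> h u \<le> h v" by blast
    have "h u < 0" using u(2)[of l] neg[of l] False \<open>x < l\<close> by simp
    then have "y < u" using nonneg[of u] by linarith
    then have "h' u \<le> h' v" if "v \<ge> z" for v
      using that h[of u] h[of v] u(1) u(2)[of v] u(2)[of x] up[of v] False
      by (cases "v \<le> x") auto
    then show "\<exists>u\<le>z. \<forall>v\<ge>z. h' u \<le> h' v" using u(1) by blast
  next
    assume "\<exists>u\<le>z. \<forall>v\<ge>z. h' u \<le> h' v"
    then obtain u where u: "u \<le> z" "\<And>v. v \<ge> z \<Longrightarrow> h' u \<le> h' v" by blast
    have "h' u < 0" using u(2)[of l] neg[of l] False \<open>x < l\<close> h[of l] by simp
    then have "y < u" using nonneg[of u] h[of u] by (cases "y < u") simp_all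
    then have "h u \<le> h v" if "v \<ge> z" for v
      using that h[of u] h[of v] u(1) u(2)[of v] False by (cases "v \<le> x") auto
    then show "\<exists>u\<le>z. \<forall>v\<ge>z. h u \<le> h v" using u(1) by blast
  qed
qed

text \<open>The pairs \<open>x\<close>, \<open>y\<close> are removed one at a time, and
  \<open>covered\<close> is preserved by the two preceding lemmas. The strict inequality of the
  sizes survives each removal and makes the lead finally negative.\<close>

lemma bully_targets_cover_iff:
  assumes "finite Y" "distinct xs" "set xs \<inter> Y = {}" "length xs < card Y"
  shows "Y \<inter> {z..} \<subseteq> set (bully_targets xs Y) \<longleftrightarrow> covered (set xs) Y z"
  using assms
proof (induction xs arbitrary: Y)
  case Nil
  show ?case
  proof
    assume "Y \<inter> {z..} \<subseteq> set (bully_targets [] Y)"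
    then have "w < z" if "w \<in> Y" for w using that by (auto simp: subset_iff not_less[symmetric])
    then have "Y \<inter> {..<v} = Y \<inter> {..<z}" if "v \<ge> z" for v
      using that by (auto intro: less_le_trans)
    then have "\<forall>v\<ge>z. lead {} Y z \<le> lead {} Y v" by (metis lead_def order_refl Int_empty_left)
    then show "covered (set []) Y z" unfolding covered_def by auto
  next
    assume "covered (set []) Y z"
    then obtain u where u: "u \<le> z" "\<forall>v\<ge>z. card (Y \<inter> {..<v}) \<le> card (Y \<inter> {..<u})"
      unfolding covered_def lead_def by auto
    have False if b: "b \<in> Y" "z \<le> b" for b
    proof -
      have "b \<in> Y \<inter> {..<Suc b}" "b \<notin> Y \<inter> {..<u}" "Y \<inter> {..<u} \<subseteq> Y \<inter> {..<Suc b}" using b u by auto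
      then have "card (Y \<inter> {..<u}) < card (Y \<inter> {..<Suc b})"
        using Nil(1) by (intro psubset_card_mono) blast+
      then show False using u(2) b by (meson le_SucI not_le)
    qed
    then show "Y \<inter> {z..} \<subseteq> set (bully_targets [] Y)" by auto
  qed
next
  case (Cons x xs)
  define y where "y = bullied x Y"
  define Y' where "Y' = Y - {y}"
  have "Y \<noteq> {}" using Cons.prems by auto
  have y: "y \<in> Y" unfolding y_def using bullied_in Cons.prems(1) \<open>Y \<noteq> {}\<close> by blast
  have x: "x \<notin> set xs" "x \<notin> Y" "x \<noteq> y" using Cons.prems y by auto
  have len: "length xs < card Y'" using Cons.prems y by (simp add: Y'_def)
  have fin: "finite Y'" using Cons.prems by (simp add: Y'_def)
  have disj: "set xs \<inter> Y' = {}" using Cons.prems by (auto simp: Y'_def)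
  have IH: "Y' \<inter> {z..} \<subseteq> set (bully_targets xs Y') \<longleftrightarrow> covered (set xs) Y' z"
    using Cons.prems len fin disj by (intro Cons.IH) auto
  have h: "lead (set (x # xs)) Y j = lead (set xs) Y' j + of_bool (x < j) - of_bool (y < j)" for j
    unfolding Y'_def using lead_remove2[of "set xs" Y x y j] Cons.prems(1) x y by simp
  have "covered (set (x # xs)) Y z \<longleftrightarrow> covered (set xs) Y' z"
  proof (cases "\<exists>y\<in>Y. x < y")
    case True
    note b = bullied_above[OF Cons.prems(1) True, folded y_def]
    show ?thesis unfolding covered_def
    proof (rule prefix_min_bump[where x = x and y = y])
      fix j
      show "lead (set (x # xs)) Y j = lead (set xs) Y' j + of_bool (x < j \<and> j \<le> y)"
        using h[of j] b(2) by auto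
      assume j: "x \<le> j" "j \<le> y"
      have "w < x" if "w \<in> Y'" "w < j" for w
        using b(3)[of w] x(2) j that by (cases w x rule: linorder_cases) (auto simp: Y'_def)
      then have "Y' \<inter> {..<j} = Y' \<inter> {..<x}" using j by auto
      moreover have "card (set xs \<inter> {..<x}) \<le> card (set xs \<inter> {..<j})"
        using j by (intro card_mono) auto
      ultimately show "lead (set xs) Y' x \<le> lead (set xs) Y' j" by (simp add: lead_def)
    qed
  next
    case False
    note b = bullied_wrap[OF Cons.prems(1) \<open>Y \<noteq> {}\<close> False, folded y_def]
    have yx: "y < x" using b x by simp
    obtain l where l: "\<forall>v \<in> set (x # xs) \<union> Y. v < l"
      using finite_nat_set_iff_bounded[of "set (x # xs) \<union> Y"] Cons.prems(1) by auto
    \<comment> \<open>An entry wraps only if all available targets lie below it, so from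
      \<open>x\<close> on the lead can only rise.\<close>
    have emp: "Y \<inter> {..<i} = Y" if "x \<le> i" for i
      using False that x(2) by auto (metis le_trans linorder_neqE_nat not_le)
    have mono: "lead (set (x # xs)) Y i \<le> lead (set (x # xs)) Y j" if "x \<le> i" "i \<le> j" for i j
    proof -
      have "card (set (x # xs) \<inter> {..<i}) \<le> card (set (x # xs) \<inter> {..<j})"
        using that by (intro card_mono) auto
      then show ?thesis using emp[of i] emp[of j] that by (simp add: lead_def)
    qed
    show ?thesis unfolding covered_def
    proof (rule prefix_min_dip[where x = x and y = y and l = l])
      fix j
      show "lead (set xs) Y' j = lead (set (x # xs)) Y j + of_bool (y < j \<and> j \<le> x)"
        using h[of j] yx by auto
      show "0 \<le> lead (set (x # xs)) Y j" if "j \<le> y"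
      proof -
        have "Y \<inter> {..<j} = {}" using b(3) that by force
        then show ?thesis by (simp add: lead_def)
      qed
      show "lead (set (x # xs)) Y j < 0" if "l \<le> j"
        using lead_eventually[of "set (x # xs)" l Y j] that l Cons.prems(2,4)
        by (auto simp: distinct_card subset_eq)
      show "lead (set (x # xs)) Y x < lead (set (x # xs)) Y j" if "x < j"
        using lead_Suc[of "set (x # xs)" Y x] Cons.prems(3) mono[of "Suc x" j] that by auto
      show "lead (set (x # xs)) Y i \<le> lead (set (x # xs)) Y j" if "x < i" "i \<le> j" for i
        using that mono by simp
    qed (use yx l in auto)
  qed
  moreover have "Y \<inter> {z..} \<subseteq> set (bully_targets (x # xs) Y) \<longleftrightarrow> Y' \<inter> {z..} \<subseteq> set (bully_targets xs Y')"
    by (auto simp: y_def Y'_def)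
  ultimately show ?case using IH by simp
qed

section \<open>The first two letters of the projected word\<close>

text \<open>The least available target is taken by any wrapping and by any entry below it, and by
  nothing else.\<close>

lemma Min_avoids_bully_targets_iff:
  assumes "finite Y" "c \<in> Y" "\<forall>y\<in>Y. c \<le> y" "c \<notin> set xs"
  shows "c \<notin> set (bully_targets xs Y) \<longleftrightarrow> (\<forall>x\<in>set xs. c < x) \<and> num_wrappings xs Y = 0"
  using assms
proof (induction xs arbitrary: Y)
  case (Cons x xs)
  define y where "y = bullied x Y"
  show ?case
  proof (cases "\<exists>y\<in>Y. x < y")
    case True
    note b = bullied_above[OF Cons.prems(1) True, folded y_def]
    show ?thesis
    proof (cases "x < c")
      case True
      then have "y = c" using b Cons.prems by (simp add: order_antisym)
      then show ?thesis using True by (auto simp: y_def)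
    next
      case False
      then have "c < x" using Cons.prems(4) by auto
      then have "y \<noteq> c" using b(2) by simp
      then have "c \<notin> set (bully_targets xs (Y - {y})) \<longleftrightarrow>
          (\<forall>x\<in>set xs. c < x) \<and> num_wrappings xs (Y - {y}) = 0"
        using Cons.prems by (intro Cons.IH) auto
      then show ?thesis using True \<open>c < x\<close> \<open>y \<noteq> c\<close> by (auto simp: y_def)
    qed
  next
    case False
    have "Y \<noteq> {}" using Cons.prems by auto
    note b = bullied_wrap[OF Cons.prems(1) this False, folded y_def]
    have "y = c" using b Cons.prems by (simp add: order_antisym)
    then show ?thesis using False by (auto simp: y_def)
  qed
qed simp

text \<open>An entry between \<open>c1\<close> and \<open>c2\<close> takes \<open>c2\<close>. An
  entry below \<open>c1\<close> takes \<open>c1\<close>, and then the single wrapping falls on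
  \<open>c2\<close>. If all entries lie beyond \<open>c2\<close>, the single wrapping is absorbed by
  \<open>c1\<close>.\<close>

lemma second_avoids_bully_targets_iff:
  assumes "finite Y" "c1 \<in> Y" "c2 \<in> Y" "c1 < c2" "\<forall>y\<in>Y. y = c1 \<or> c2 \<le> y"
    "c1 \<notin> set xs" "c2 \<notin> set xs" "num_wrappings xs Y = 1"
  shows "c2 \<notin> set (bully_targets xs Y) \<longleftrightarrow> (\<forall>x\<in>set xs. c2 < x)"
  using assms
proof (induction xs arbitrary: Y)
  case (Cons x xs)
  define y where "y = bullied x Y"
  \<comment> \<open>Once \<open>c1\<close> is gone, \<open>c2\<close> is the least available
    target.\<close>
  have min: "c2 \<notin> set (bully_targets xs (Y - {c1})) \<longleftrightarrow>
      (\<forall>x\<in>set xs. c2 < x) \<and> num_wrappings xs (Y - {c1}) = 0"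
    using Cons.prems by (intro Min_avoids_bully_targets_iff) auto
  show ?case
  proof (cases "\<exists>y\<in>Y. x < y")
    case True
    note b = bullied_above[OF Cons.prems(1) True, folded y_def]
    have nw: "num_wrappings xs (Y - {y}) = 1" using True Cons.prems(8) by (simp add: y_def)
    consider "x < c1" | "c1 < x" "x < c2" | "c2 < x" using Cons.prems(6,7) by fastforce
    then show ?thesis
    proof cases
      case 1
      then have "y = c1" using b(1) b(3)[of c1] Cons.prems(2,4,5) by fastforce
      then have "c2 \<in> set (bully_targets xs (Y - {y}))" using min nw by auto
      then show ?thesis using 1 Cons.prems(4) by (auto simp: y_def)
    next
      case 2
      then have "y = c2" using b(1,2) b(3)[of c2] Cons.prems(3,5) by fastforce
      then show ?thesis using 2 by (auto simp: y_def)
    next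
      case 3
      then have "y \<noteq> c1" "y \<noteq> c2" using b(2) Cons.prems(4) by auto
      then have "c2 \<notin> set (bully_targets xs (Y - {y})) \<longleftrightarrow> (\<forall>x\<in>set xs. c2 < x)"
        using Cons.prems nw by (intro Cons.IH) auto
      then show ?thesis using 3 \<open>y \<noteq> c2\<close> by (auto simp: y_def)
    qed
  next
    case False
    have "Y \<noteq> {}" using Cons.prems by auto
    note b = bullied_wrap[OF Cons.prems(1) this False, folded y_def]
    have y: "y = c1" using b(1) b(3)[of c1] Cons.prems(2,4,5) by fastforce
    have "\<not> x < c2" "x \<noteq> c2" using False Cons.prems(3,7) by auto
    then have "c2 < x" by simp
    moreover have "num_wrappings xs (Y - {c1}) = 0" using Cons.prems(8) False y by (simp add: y_def)
    ultimately show ?thesis using min y Cons.prems(4) by (auto simp: y_def)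
  qed
qed simp

text \<open>Entries beyond \<open>c2\<close> reach \<open>c1\<close> only by wrapping, and a second
  wrapping would take \<open>c2\<close>.\<close>

lemma first_in_bully_targets_iff:
  assumes "finite Y" "c1 \<in> Y" "c2 \<in> Y" "c1 < c2" "\<forall>y\<in>Y. y = c1 \<or> c2 \<le> y"
    "\<forall>x\<in>set xs. c2 < x" "c2 \<notin> set (bully_targets xs Y)"
  shows "c1 \<in> set (bully_targets xs Y) \<longleftrightarrow> num_wrappings xs Y = 1"
  using assms
proof (induction xs arbitrary: Y)
  case (Cons x xs)
  define y where "y = bullied x Y"
  have c2: "c2 \<notin> set (bully_targets xs (Y - {y}))" "y \<noteq> c2" using Cons.prems(7) by (auto simp: y_def)
  show ?case
  proof (cases "\<exists>y\<in>Y. x < y")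
    case True
    note b = bullied_above[OF Cons.prems(1) True, folded y_def]
    have "y \<noteq> c1" using b(2) Cons.prems(4,6) by auto
    then have "c1 \<in> set (bully_targets xs (Y - {y})) \<longleftrightarrow> num_wrappings xs (Y - {y}) = 1"
      using Cons.prems c2 by (intro Cons.IH) auto
    then show ?thesis using True \<open>y \<noteq> c1\<close> by (auto simp: y_def)
  next
    case False
    have "Y \<noteq> {}" using Cons.prems by auto
    note b = bullied_wrap[OF Cons.prems(1) this False, folded y_def]
    have y: "y = c1" using b(1) b(3)[of c1] Cons.prems(2,4,5) by fastforce
    have "c2 \<notin> set (bully_targets xs (Y - {c1})) \<longleftrightarrow>
        (\<forall>x\<in>set xs. c2 < x) \<and> num_wrappings xs (Y - {c1}) = 0"
      using Cons.prems by (intro Min_avoids_bully_targets_iff) auto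
    then have "num_wrappings xs (Y - {c1}) = 0" using c2 y by simp
    then show ?thesis using False y by (simp add: y_def)
  qed
qed simp

text \<open>With one wrapping in all, the second letter is 3 exactly if all of row 2 lies beyond the
  second entry of row 3; then the first letter is 1 exactly if the wrapping path starts in row 1.
  The walks turn this into a cut at maximal excess from which all of row 2 is bullied from row
  1.\<close>

lemma cmlq_condition_iff:
  assumes q: "is_cmlq s t u (as, bs, cs)" and "t \<ge> 1" "u \<ge> 1" "s \<ge> 1"
  defines "A \<equiv> set as" and "B \<equiv> set bs" and "C \<equiv> set cs"
  shows "wrappings23 (as, bs, cs) = 1 \<and> projected_word (as, bs, cs) ! 0 = 1 \<and>
      projected_word (as, bs, cs) ! 1 = 3 \<longleftrightarrow>
    (\<forall>b\<in>B. 2 \<le> card (C \<inter> {..<b})) \<and> (\<forall>z. excess B C z \<le> 1) \<and>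
      (\<exists>z. excess B C z = 1 \<and> covered A B z)"
proof -
  have len: "length as = s" "length bs = s + t" "length cs = s + t + u"
    and srt: "sorted_wrt (<) cs" and dist: "distinct as" "distinct bs" "distinct cs"
    and disj: "A \<inter> B = {}" "B \<inter> C = {}"
    using q by (auto simp: is_cmlq_def A_def B_def C_def)
  have fin: "finite A" "finite B" "finite C" by (simp_all add: A_def B_def C_def)
  have cB: "card B = s + t" and cC: "card C = s + t + u"
    using len dist by (simp_all add: B_def C_def distinct_card)
  define r1 where "r1 = row2_first (as, bs, cs)"
  define r2 where "r2 = row2_second (as, bs, cs)"
  have r1: "r1 = bully_targets as B" by (simp add: r1_def row2_first_def B_def)
  have r2: "r2 = filter (\<lambda>b. b \<notin> set r1) bs" by (simp add: r2_def r1_def row2_second_def)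
  have r1B: "set r1 \<subseteq> B" "distinct r1"
    using set_bully_targets[of B as] fin cB len r1 by auto
  have xs: "set (r1 @ r2) = B" "distinct (r1 @ r2)" using r1B dist r2 by (auto simp: B_def)
  have lxs: "length (r1 @ r2) = s + t" using distinct_card[OF xs(2)] xs(1) cB by simp
  have lr1: "length r1 = s" using r1 len by simp
  have e1: "endpoints1 (as, bs, cs) = set (bully_targets r1 C)"
    by (simp add: endpoints1_def r1_def C_def)
  have e2: "endpoints2 (as, bs, cs) = set (bully_targets r2 (C - set (bully_targets r1 C)))"
    by (simp add: endpoints2_def r2_def C_def e1[unfolded C_def])
  have e12: "set (bully_targets (r1 @ r2) C) = endpoints1 (as, bs, cs) \<union> endpoints2 (as, bs, cs)"
    by (simp add: bully_targets_append e1 e2)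
  have w: "wrappings23 (as, bs, cs) = num_wrappings (r1 @ r2) C"
    by (simp add: wrappings23_def num_wrappings_append e1[unfolded C_def] r1_def[symmetric] r2_def[symmetric] C_def)
  define c1 where "c1 = cs ! 0"
  define c2 where "c2 = cs ! 1"
  have lc: "0 < length cs" "1 < length cs" using len assms(2-4) by auto
  have p0: "projected_word (as, bs, cs) ! 0 = 1 \<longleftrightarrow> c1 \<in> endpoints1 (as, bs, cs)"
    using lc by (simp add: projected_word_def c1_def)
  have p1: "projected_word (as, bs, cs) ! 1 = 3 \<longleftrightarrow> c2 \<notin> set (bully_targets (r1 @ r2) C)"
    using lc unfolding e12 by (simp add: projected_word_def c2_def)
  have c: "c1 \<in> C" "c2 \<in> C" "c1 < c2"
    using lc srt by (auto simp: c1_def c2_def C_def sorted_wrt_iff_nth_less)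
  have cle: "\<forall>y\<in>C. y = c1 \<or> c2 \<le> y"
  proof
    fix y assume "y \<in> C"
    then obtain i where i: "i < length cs" "y = cs ! i" by (auto simp: C_def in_set_conv_nth)
    show "y = c1 \<or> c2 \<le> y"
    proof (cases "i = 0 \<or> i = 1")
      case True then show ?thesis using i by (auto simp: c1_def c2_def)
    next
      case False
      then show ?thesis using i srt by (simp add: c2_def sorted_wrt_iff_nth_less less_imp_le)
    qed
  qed
  have cnB: "c1 \<notin> B" "c2 \<notin> B" using c disj by auto
  have two: "2 \<le> card (C \<inter> {..<b}) \<longleftrightarrow> c2 < b" if "b \<in> B" for b
  proof
    assume 2: "2 \<le> card (C \<inter> {..<b})"
    show "c2 < b"
    proof (rule ccontr)
      assume "\<not> c2 < b"
      then have "C \<inter> {..<b} \<subseteq> {c1}" using cle by fastforce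
      then have "card (C \<inter> {..<b}) \<le> card {c1}" by (intro card_mono) auto
      then show False using 2 by simp
    qed
  next
    assume "c2 < b"
    then have "{c1, c2} \<subseteq> C \<inter> {..<b}" using c by auto
    then have "card {c1, c2} \<le> card (C \<inter> {..<b})" using fin by (intro card_mono) auto
    then show "2 \<le> card (C \<inter> {..<b})" using c(3) by simp
  qed
  have word: "wrappings23 (as, bs, cs) = 1 \<and> projected_word (as, bs, cs) ! 0 = 1 \<and>
      projected_word (as, bs, cs) ! 1 = 3 \<longleftrightarrow>
    (\<forall>b\<in>B. c2 < b) \<and> num_wrappings (r1 @ r2) C = 1 \<and> num_wrappings r1 C = 1"
  proof (cases "num_wrappings (r1 @ r2) C = 1")
    case True
    have "c2 \<notin> set (bully_targets (r1 @ r2) C) \<longleftrightarrow> (\<forall>x\<in>set (r1 @ r2). c2 < x)"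
      using fin c cle True by (intro second_avoids_bully_targets_iff[of C c1]) (use xs(1) cnB in blast)+
    then have 1: "c2 \<notin> set (bully_targets (r1 @ r2) C) \<longleftrightarrow> (\<forall>b\<in>B. c2 < b)" by (simp only: xs(1))
    have 2: "c1 \<in> set (bully_targets r1 C) \<longleftrightarrow> num_wrappings r1 C = 1"
      if "\<forall>b\<in>B. c2 < b"
    proof (rule first_in_bully_targets_iff[OF fin(3) c cle])
      show "\<forall>x\<in>set r1. c2 < x" using that r1B(1) by blast
      show "c2 \<notin> set (bully_targets r1 C)" using that 1 e1 e12 by blast
    qed
    show ?thesis using 1 2 True w p0 p1 e1 by metis
  next
    case False
    then show ?thesis using w by simp
  qed
  have nw1: "num_wrappings r1 C \<le> k \<longleftrightarrow> (\<forall>z. excess (set r1) C z \<le> int k)" for k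
    using fin r1B disj lr1 cC by (intro num_wrappings_le_iff) auto
  have nw: "num_wrappings (r1 @ r2) C \<le> k \<longleftrightarrow> (\<forall>z. excess B C z \<le> int k)" for k
    using num_wrappings_le_iff[of C "r1 @ r2" k] fin xs disj lxs cC by simp
  have cov: "B \<inter> {z..} \<subseteq> set r1 \<longleftrightarrow> covered A B z" for z
    unfolding r1 A_def using fin dist disj len cB \<open>t \<ge> 1\<close>
    by (intro bully_targets_cover_iff) (auto simp: A_def)
  have "num_wrappings (r1 @ r2) C = 1 \<and> num_wrappings r1 C = 1 \<longleftrightarrow>
    (\<forall>z. excess B C z \<le> 1) \<and> (\<exists>z. excess B C z = 1 \<and> covered A B z)"
  proof
    assume *: "num_wrappings (r1 @ r2) C = 1 \<and> num_wrappings r1 C = 1"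
    then have le: "\<forall>z. excess B C z \<le> 1" using nw[of 1] by simp
    \<comment> \<open>Already the entries in \<open>r1\<close> have positive excess here, while all
      of \<open>B\<close> has excess at most 1. So no entry of \<open>r2\<close> lies from
      \<open>z\<close> on.\<close>
    obtain z where z: "excess (set r1) C z > 0" using nw1[of 0] * by (auto simp: not_le)
    have sub: "set r1 \<inter> {z..} \<subseteq> B \<inter> {z..}" using r1B by auto
    have leB: "card (set r1 \<inter> {z..}) \<le> card (B \<inter> {z..})" using sub fin by (intro card_mono) auto
    have "excess B C z = 1 \<and> card (set r1 \<inter> {z..}) = card (B \<inter> {z..})"
      using z leB le[rule_format, of z] unfolding excess_def by linarith
    moreover from this have "set r1 \<inter> {z..} = B \<inter> {z..}"
      using sub fin by (intro card_subset_eq) auto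
    ultimately have "excess B C z = 1 \<and> covered A B z" using cov[of z] by blast
    then show "(\<forall>z. excess B C z \<le> 1) \<and> (\<exists>z. excess B C z = 1 \<and> covered A B z)" using le by blast
  next
    assume *: "(\<forall>z. excess B C z \<le> 1) \<and> (\<exists>z. excess B C z = 1 \<and> covered A B z)"
    then have "num_wrappings (r1 @ r2) C \<le> 1" using nw[of 1] by simp
    moreover have "num_wrappings r1 C \<le> num_wrappings (r1 @ r2) C" by (simp add: num_wrappings_append)
    moreover obtain z where z: "excess B C z = 1" "covered A B z" using * by blast
    \<comment> \<open>At a covered cut \<open>B\<close> and \<open>r1\<close> agree from there on,
      so the paths from row 1 alone force a wrapping.\<close>
    then have "B \<inter> {z..} = set r1 \<inter> {z..}" using cov r1B by blast
    then have "excess (set r1) C z = 1" using z by (simp add: excess_def)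
    then have "\<not> num_wrappings r1 C \<le> 0" using nw1[of 0] by (metis int_one_le_iff_zero_less not_le of_nat_0 zero_less_one)
    ultimately show "num_wrappings (r1 @ r2) C = 1 \<and> num_wrappings r1 C = 1" by linarith
  qed
  then show ?thesis using word two by blast
qed

section \<open>Removal of the largest entry\<close>

lemma beta13_eq_card_queues:
  assumes "s \<ge> 1" "t \<ge> 1" "n > s + t"
  shows "beta13 s t n = card (queues 2 (n + 2 * s + t - 1) s (s + t))"
proof -
  define N where "N = n + 2 * s + t"
  define \<phi> :: "nat list \<times> nat list \<times> nat list \<Rightarrow> nat set \<times> nat set \<times> nat set"
    where "\<phi> = (\<lambda>(as, bs, cs). (set as, set bs, set cs - {N}))"
  define M where "M = {(as, bs, cs).
     is_cmlq s t (n - s - t) (as, bs, cs) \<and> N \<in> set cs \<and> wrappings23 (as, bs, cs) = 1 \<and>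
     projected_word (as, bs, cs) ! 0 = 1 \<and> projected_word (as, bs, cs) ! 1 = 3}"
  have M_iff: "(as, bs, cs) \<in> M \<longleftrightarrow> is_cmlq s t (n - s - t) (as, bs, cs) \<and> N \<in> set cs \<and>
    (\<forall>b\<in>set bs. 2 \<le> card (set cs \<inter> {..<b})) \<and> (\<forall>z. excess (set bs) (set cs) z \<le> 1) \<and>
      (\<exists>z. excess (set bs) (set cs) z = 1 \<and> covered (set as) (set bs) z)" for as bs cs
  proof -
    have "n - s - t \<ge> 1" using assms by simp
    from cmlq_condition_iff[OF _ assms(2) this assms(1)] show ?thesis unfolding M_def by blast
  qed
  \<comment> \<open>Deleting \<open>N\<close> raises the excess by 1 at every cut up to
    \<open>N\<close>, while behind \<open>N\<close> it is 0 before and after. Hence level 1 becomes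
    level 2. As \<open>N\<close> lies beyond all b's, the condition on two earlier c's is
    unaffected.\<close>
  have key: "(\<forall>b\<in>B. 2 \<le> card (C \<inter> {..<b})) \<and> (\<forall>z. excess B C z \<le> 1) \<and>
      (\<exists>z. excess B C z = 1 \<and> covered A B z) \<longleftrightarrow>
    (\<forall>b\<in>B. 2 \<le> card ((C - {N}) \<inter> {..<b})) \<and> (\<forall>z. excess B (C - {N}) z \<le> 2) \<and>
      (\<exists>z. excess B (C - {N}) z = 2 \<and> covered A B z)"
    if "B \<subseteq> {1..N}" "C \<subseteq> {1..N}" "N \<in> C" "N \<notin> B" for A B C
  proof -
    have "finite C" using that finite_subset by blast
    have "(C - {N}) \<inter> {..<b} = C \<inter> {..<b}" if "b \<in> B" for b using that \<open>B \<subseteq> {1..N}\<close> by fastforce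
    moreover have g: "excess B C z = excess B (C - {N}) z - of_bool (z \<le> N)" for z
      using card_remove_Int[OF \<open>finite C\<close> \<open>N \<in> C\<close>, of "{z..}"] by (simp add: excess_def)
    moreover have g0: "excess B (C - {N}) z = 0" if "\<not> z \<le> N" for z
      using \<open>B \<subseteq> {1..N}\<close> \<open>C \<subseteq> {1..N}\<close> that by (intro excess_eventually[of _ "Suc N"]) fastforce+
    have "excess B C z \<le> 1 \<longleftrightarrow> excess B (C - {N}) z \<le> 2"
      "excess B C z = 1 \<longleftrightarrow> excess B (C - {N}) z = 2" for z
      using g[of z] g0[of z] by (cases "z \<le> N"; simp)+
    ultimately show ?thesis by simp
  qed
  have cmlq: "set as \<union> set bs \<union> set cs = {1..N}" "set as \<inter> set bs = {}" "set as \<inter> set cs = {}"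
      "set bs \<inter> set cs = {}" "sorted_wrt (<) as" "sorted_wrt (<) bs" "sorted_wrt (<) cs"
      "card (set as) = s" "card (set bs) = s + t"
    if "is_cmlq s t (n - s - t) (as, bs, cs)" for as bs cs
  proof -
    have "length as + length bs + length cs = N" using that assms by (auto simp: is_cmlq_def N_def)
    then show "set as \<union> set bs \<union> set cs = {1..N}"
      using that by (simp add: is_cmlq_def Un_assoc)
  qed (use that in \<open>auto simp: is_cmlq_def distinct_card\<close>)
  have "inj_on \<phi> M"
  proof (rule inj_onI)
    fix x y assume xy: "x \<in> M" "y \<in> M" "\<phi> x = \<phi> y"
    obtain as bs cs as' bs' cs' where eq: "x = (as, bs, cs)" "y = (as', bs', cs')"
      by (cases x; cases y)
    have q: "is_cmlq s t (n - s - t) (as, bs, cs)" "is_cmlq s t (n - s - t) (as', bs', cs')"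
      "N \<in> set cs" "N \<in> set cs'" using xy M_iff eq by auto
    have "set as = set as'" "set bs = set bs'" "set cs = set cs'"
      using xy(3) q(3,4) by (auto simp: \<phi>_def eq)
    then show "x = y" using cmlq(5-7)[OF q(1)] cmlq(5-7)[OF q(2)] unfolding eq
      by (simp add: strict_sorted_equal)
  qed
  moreover have "\<phi> ` M = queues 2 (N - 1) s (s + t)"
  proof (intro equalityI subsetI)
    fix x assume "x \<in> \<phi> ` M"
    then obtain as bs cs where x: "x = (set as, set bs, set cs - {N})" and m: "(as, bs, cs) \<in> M"
      by (auto simp: \<phi>_def)
    have q: "is_cmlq s t (n - s - t) (as, bs, cs)" "N \<in> set cs" using m M_iff by auto
    note c = cmlq[OF q(1)]
    have u: "set as \<union> set bs \<union> (set cs - {N}) = {1..N - 1}"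
    proof -
      have "set as \<union> set bs \<union> (set cs - {N}) = {1..N} - {N}" using c(1-4) q(2) by blast
      also have "{1..N} - {N} = {1..N - 1}" by auto
      finally show ?thesis .
    qed
    have sub: "set bs \<subseteq> {1..N}" "set cs \<subseteq> {1..N}" "N \<notin> set bs" using c(1,4) q(2) by blast+
    have "(\<forall>b\<in>set bs. 2 \<le> card ((set cs - {N}) \<inter> {..<b})) \<and> (\<forall>z. excess (set bs) (set cs - {N}) z \<le> 2) \<and>
      (\<exists>z. excess (set bs) (set cs - {N}) z = 2 \<and> covered (set as) (set bs) z)"
      using m[unfolded M_iff] by (intro iffD1[OF key[OF sub(1,2) q(2) sub(3)]]) simp
    moreover have "set as \<inter> (set cs - {N}) = {}" "set bs \<inter> (set cs - {N}) = {}" using c(3,4) by auto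
    ultimately show "x \<in> queues 2 (N - 1) s (s + t)"
      using u c(2,8,9) unfolding queues_def arrangement_def x mem_Collect_eq prod.case
      by (elim conjE, intro conjI) assumption+
  next
    fix x assume "x \<in> queues 2 (N - 1) s (s + t)"
    then obtain A B C where x: "x = (A, B, C)" and arr: "arrangement (N - 1) s (s + t) A B C"
      and rest: "\<forall>z. excess B C z \<le> 2" "\<exists>z. excess B C z = 2 \<and> covered A B z"
      unfolding queues_def by blast
    note sub = arrangementD[OF arr]
    have N: "N \<ge> 1" using assms by (simp add: N_def)
    have un: "A \<union> B \<union> C = {1..N - 1}" and two: "\<forall>b\<in>B. 2 \<le> card (C \<inter> {..<b})"
      using arr by (auto simp: arrangement_def)
    have Nn: "N \<notin> A" "N \<notin> B" "N \<notin> C" using sub(1-3) N by auto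
    have C: "insert N C - {N} = C" using Nn by auto
    have "card (A \<union> B \<union> C) = N - 1" using un by simp
    moreover have "card (A \<union> B \<union> C) = s + (s + t) + card C"
      using sub(4-11) by (subst card_Un_disjoint; simp add: card_Un_disjoint Int_Un_distrib2)
    ultimately have cC: "card (insert N C) = n" using Nn sub assms by (simp add: N_def)
    define D where "D = insert N C"
    have D: "finite D" "card D = n" using sub cC by (simp_all add: D_def)
    define as bs cs where "as = sorted_list_of_set A" and "bs = sorted_list_of_set B"
      and "cs = sorted_list_of_set D"
    have sets: "set as = A" "set bs = B" "set cs = D" using sub D by (simp_all add: as_def bs_def cs_def)
    have lens: "length as = s" "length bs = s + t" "length cs = n"
      using sub D by (simp_all add: as_def bs_def cs_def)
    have "A \<union> B \<union> D = insert N {1..N - 1}" using un unfolding D_def by blast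
    also have "insert N {1..N - 1} = {1..N}" using N by auto
    finally have un': "A \<union> B \<union> D = {1..N}" .
    have "A \<inter> D = {}" "B \<inter> D = {}" using sub(8,9) Nn by (auto simp: D_def)
    then have "distinct (as @ bs @ cs)" using sub(7) unfolding distinct_append set_append sets
      by (auto simp: as_def bs_def cs_def)
    moreover have "length as + length bs + length cs = N" using lens by (simp add: N_def)
    then have "set (as @ bs @ cs) = {1..length as + length bs + length cs}"
      using un' sets by (simp add: Un_assoc)
    ultimately have "is_cmlq s t (n - s - t) (as, bs, cs)"
      using lens assms by (simp add: is_cmlq_def) (simp add: as_def bs_def cs_def)
    moreover have sub': "B \<subseteq> {1..N}" "insert N C \<subseteq> {1..N}" using un' unfolding D_def by blast+
    moreover note iffD2[OF key[OF sub' insertI1 Nn(2), unfolded C], of A]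
    ultimately have "(as, bs, cs) \<in> M" using rest two unfolding M_iff sets D_def by simp
    moreover have "\<phi> (as, bs, cs) = x" using sets C by (simp add: \<phi>_def x D_def)
    ultimately show "x \<in> \<phi> ` M" by blast
  qed
  ultimately have "card M = card (queues 2 (N - 1) s (s + t))" using card_image by metis
  then show ?thesis unfolding beta13_def M_def N_def by simp
qed

section \<open>Two-row standard tableaux as ballot sequences\<close>

text \<open>Such an \<open>R\<close> is the second row of a standard tableau with \<open>q\<close>
  entries, which determines the tableau.\<close>

definition ballot_sets :: "nat \<Rightarrow> nat \<Rightarrow> nat set set" where
  "ballot_sets q m = {R. R \<subseteq> {1..q} \<and> card R = m \<and>
     (\<forall>z. card (R \<inter> {..z}) \<le> card (({1..q} - R) \<inter> {..z}))}"

text \<open>Each entry of \<open>ys\<close> up to \<open>z\<close> has a smaller partner of the same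
  index in \<open>xs\<close>. Conversely, a bad column \<open>j\<close> is detected at
  \<open>z = ys ! j\<close>: \<open>j + 1\<close> entries of \<open>ys\<close> are that small, but
  at most \<open>j\<close> entries of \<open>xs\<close>.\<close>

lemma columns_increasing_iff:
  fixes xs ys :: "nat list"
  assumes "sorted_wrt (<) xs" "sorted_wrt (<) ys" "set xs \<inter> set ys = {}" "length ys \<le> length xs"
  shows "(\<forall>j<length ys. xs ! j < ys ! j) \<longleftrightarrow> (\<forall>z. card (set ys \<inter> {..z}) \<le> card (set xs \<inter> {..z}))"
proof (intro iffI allI impI)
  fix z assume *: "\<forall>j<length ys. xs ! j < ys ! j"
  define J where "J = {j. j < length ys \<and> ys ! j \<le> z}"
  have "finite J" unfolding J_def by simp
  have "set ys \<inter> {..z} = (!) ys ` J" unfolding J_def by (auto simp: in_set_conv_nth)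
  then have "card (set ys \<inter> {..z}) \<le> card J" using card_image_le \<open>finite J\<close> by metis
  also have "card J = card ((!) xs ` J)"
    using assms by (intro card_image[symmetric] inj_on_nth) (auto simp: J_def strict_sorted_iff)
  also have "\<dots> \<le> card (set xs \<inter> {..z})"
  proof (intro card_mono subsetI)
    fix x assume "x \<in> (!) xs ` J"
    then obtain j where j: "j < length ys" "ys ! j \<le> z" "x = xs ! j" by (auto simp: J_def)
    then show "x \<in> set xs \<inter> {..z}" using *[rule_format, OF j(1)] assms(4) by simp
  qed simp
  finally show "card (set ys \<inter> {..z}) \<le> card (set xs \<inter> {..z})" .
next
  fix j assume *: "\<forall>z. card (set ys \<inter> {..z}) \<le> card (set xs \<inter> {..z})" and j: "j < length ys"
  show "xs ! j < ys ! j"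
  proof (rule ccontr)
    assume "\<not> xs ! j < ys ! j"
    moreover have "xs ! j \<in> set xs" "ys ! j \<in> set ys" using j assms(4) by auto
    then have "xs ! j \<noteq> ys ! j" using assms(3) by auto
    ultimately have lt: "ys ! j < xs ! j" by simp
    have "Suc j = card ((!) ys ` {..j})"
      using assms j by (subst card_image) (auto intro!: inj_on_nth simp: strict_sorted_iff)
    also have "\<dots> \<le> card (set ys \<inter> {..ys ! j})"
    proof (intro card_mono subsetI)
      fix y assume "y \<in> (!) ys ` {..j}"
      then obtain i where i: "i \<le> j" "y = ys ! i" by auto
      then have "y \<le> ys ! j" using assms(2) j by (cases "i = j") (auto simp: sorted_wrt_iff_nth_less less_imp_le)
      then show "y \<in> set ys \<inter> {..ys ! j}" using i j by simp
    qed simp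
    also have "\<dots> \<le> card (set xs \<inter> {..ys ! j})" using * by blast
    also have "\<dots> \<le> card ((!) xs ` {..<j})"
    proof (intro card_mono subsetI)
      fix x assume x: "x \<in> set xs \<inter> {..ys ! j}"
      then obtain i where i: "i < length xs" "x = xs ! i" by (auto simp: in_set_conv_nth)
      have "i < j"
      proof (rule ccontr)
        assume "\<not> i < j"
        then have "xs ! j \<le> xs ! i"
          using assms(1) i by (cases "i = j") (auto simp: sorted_wrt_iff_nth_less less_imp_le)
        then show False using x lt i by simp
      qed
      then show "x \<in> (!) xs ` {..<j}" using i by simp
    qed simp
    also have "\<dots> \<le> j" using card_image_le[of "{..<j}" "(!) xs"] by simp
    finally show False by simp
  qed
qed

lemma is_SYT_two_rows_iff:
  "is_SYT [p, m] T \<longleftrightarrow> (\<exists>xs ys. T = [xs, ys] \<and> length xs = p \<and> length ys = m \<and>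
     sorted_wrt (<) xs \<and> sorted_wrt (<) ys \<and> (\<forall>j<m. xs ! j < ys ! j) \<and>
     set xs \<inter> set ys = {} \<and> set xs \<union> set ys = {1..p + m})"
proof (cases "\<exists>xs ys. T = [xs, ys]")
  case True
  then obtain xs ys where T: "T = [xs, ys]" by blast
  have "(\<forall>i j. Suc i < length T \<and> j < length (T ! Suc i) \<longrightarrow> T ! i ! j < T ! Suc i ! j) \<longleftrightarrow>
    (\<forall>j<length ys. xs ! j < ys ! j)" unfolding T by (auto simp: less_Suc_eq)
  then show ?thesis unfolding is_SYT_def by (auto simp: T strict_sorted_iff)
next
  case False
  have "map length T \<noteq> [p, m]"
  proof
    assume "map length T = [p, m]"
    then have "length T = 2" by (metis length_map length_Cons list.size(3) numeral_2_eq_2)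
    then have "\<exists>xs ys. T = [xs, ys]" by (auto simp: length_Suc_conv numeral_2_eq_2)
    with False show False by simp
  qed
  then show ?thesis using False unfolding is_SYT_def by blast
qed

lemma num_SYT_two_rows:
  assumes "m \<le> p"
  shows "num_SYT [p, m] = card (ballot_sets (p + m) m)"
proof -
  have "bij_betw (\<lambda>T. set (T ! 1)) {T. is_SYT [p, m] T} (ballot_sets (p + m) m)"
  proof (rule bij_betw_byWitness[where f' = "\<lambda>R. [sorted_list_of_set ({1..p + m} - R), sorted_list_of_set R]"])
    show "\<forall>T\<in>{T. is_SYT [p, m] T}.
      [sorted_list_of_set ({1..p + m} - set (T ! 1)), sorted_list_of_set (set (T ! 1))] = T"
    proof
      fix T assume "T \<in> {T. is_SYT [p, m] T}"
      then obtain xs ys where T: "T = [xs, ys]" "sorted_wrt (<) xs" "sorted_wrt (<) ys"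
        "set xs \<inter> set ys = {}" "set xs \<union> set ys = {1..p + m}"
        unfolding is_SYT_two_rows_iff by blast
      have "{1..p + m} - set ys = set xs" using T(4,5) by blast
      then show "[sorted_list_of_set ({1..p + m} - set (T ! 1)), sorted_list_of_set (set (T ! 1))] = T"
        using T(1-3) by (simp add: sorted_list_of_set_unique strict_sorted_iff sorted_list_of_set.idem_if_sorted_distinct)
    qed
    have cond: "(\<forall>j<m. xs ! j < ys ! j) \<longleftrightarrow> (\<forall>z. card (set ys \<inter> {..z}) \<le> card (set xs \<inter> {..z}))"
      if "sorted_wrt (<) xs" "sorted_wrt (<) ys" "set xs \<inter> set ys = {}" "length xs = p" "length ys = m"
      for xs ys :: "nat list"
      using columns_increasing_iff[of xs ys] that assms by simp
    show "(\<lambda>T. set (T ! 1)) ` {T. is_SYT [p, m] T} \<subseteq> ballot_sets (p + m) m"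
    proof clarify
      fix T assume "is_SYT [p, m] T"
      then obtain xs ys where T: "T = [xs, ys]" "length xs = p" "length ys = m"
        "sorted_wrt (<) xs" "sorted_wrt (<) ys" "\<forall>j<m. xs ! j < ys ! j"
        "set xs \<inter> set ys = {}" "set xs \<union> set ys = {1..p + m}"
        unfolding is_SYT_two_rows_iff by blast
      have x: "{1..p + m} - set ys = set xs" and s: "set ys \<subseteq> {1..p + m}" using T(7,8) by blast+
      have "card (set ys) = m" using T(3,5) by (simp add: distinct_card strict_sorted_iff)
      moreover have "\<forall>z. card (set ys \<inter> {..z}) \<le> card (set xs \<inter> {..z})" using cond[of xs ys] T by blast
      ultimately have "set ys \<in> ballot_sets (p + m) m"
        using s unfolding ballot_sets_def mem_Collect_eq x by blast
      then show "set (T ! 1) \<in> ballot_sets (p + m) m" using T(1) by simp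
    qed
    show "\<forall>R\<in>ballot_sets (p + m) m.
      set ([sorted_list_of_set ({1..p + m} - R), sorted_list_of_set R] ! 1) = R"
    proof
      fix R assume "R \<in> ballot_sets (p + m) m"
      then have "finite R" unfolding ballot_sets_def using finite_subset by blast
      then show "set ([sorted_list_of_set ({1..p + m} - R), sorted_list_of_set R] ! 1) = R" by simp
    qed
    show "(\<lambda>R. [sorted_list_of_set ({1..p + m} - R), sorted_list_of_set R]) ` ballot_sets (p + m) m
      \<subseteq> {T. is_SYT [p, m] T}"
    proof clarify
      fix R assume R: "R \<in> ballot_sets (p + m) m"
      define xs ys where "xs = sorted_list_of_set ({1..p + m} - R)" and "ys = sorted_list_of_set R"
      have sub: "R \<subseteq> {1..p + m}" "card R = m" and bal: "\<forall>z. card (R \<inter> {..z}) \<le> card (({1..p + m} - R) \<inter> {..z})"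
        using R by (auto simp: ballot_sets_def)
      have fin: "finite R" using sub finite_subset by blast
      have sets: "set xs = {1..p + m} - R" "set ys = R" using fin by (simp_all add: xs_def ys_def)
      have srt: "sorted_wrt (<) xs" "sorted_wrt (<) ys" by (simp_all add: xs_def ys_def)
      have len: "length xs = p" "length ys = m"
        using fin sub by (simp_all add: xs_def ys_def card_Diff_subset)
      have disj: "set xs \<inter> set ys = {}" and un: "set xs \<union> set ys = {1..p + m}" unfolding sets using sub by auto
      have "\<forall>j<m. xs ! j < ys ! j" using cond[OF srt disj len] bal unfolding sets by blast
      then have "is_SYT [p, m] [xs, ys]" unfolding is_SYT_two_rows_iff using len srt disj un by blast
      then show "is_SYT [p, m] [sorted_list_of_set ({1..p + m} - R), sorted_list_of_set R]"
        by (simp only: xs_def ys_def)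
    qed
  qed
  then show ?thesis unfolding num_SYT_def by (rule bij_betw_same_card)
qed

section \<open>Counting at level 0\<close>

text \<open>\<open>X\<close> will be the complement of the positions of the a's, hence in general
  not an interval.\<close>

definition reverse_ballots :: "nat set \<Rightarrow> nat \<Rightarrow> nat set set" where
  "reverse_ballots X m = {B. B \<subseteq> X \<and> card B = m \<and> (\<forall>b\<in>B. 2 \<le> card ((X - B) \<inter> {..<b})) \<and>
     (\<forall>z. card (B \<inter> {z..}) \<le> card ((X - B) \<inter> {z..}))}"

text \<open>The two least elements of \<open>X\<close> are forced to lie outside \<open>B\<close>.
  Removing them and numbering the others from the largest down turns suffix conditions into prefix
  conditions.\<close>

lemma card_reverse_ballots:
  assumes "finite X" "card X = q + 2"
  shows "card (reverse_ballots X m) = card (ballot_sets q m)"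
proof -
  define xs where "xs = sorted_list_of_set X"
  have xs: "set xs = X" "length xs = q + 2" using assms by (simp_all add: xs_def)
  have srt: "xs ! i < xs ! j" if "i < j" "j < q + 2" for i j
    using that xs(2) sorted_wrt_nth_less[of "(<)" xs i j] by (simp add: xs_def)
  \<comment> \<open>For \<open>i\<close> from 1 to \<open>q\<close> this is the \<open>i\<close>-th
    largest element of \<open>X\<close>; indices 0 and 1 of \<open>xs\<close>, the two forced
    elements, are never reached.\<close>
  define e where "e i = xs ! (q + 2 - i)" for i
  have e_mono: "e j < e i" if "i < j" "1 \<le> i" "j \<le> q" for i j
    unfolding e_def using that by (intro srt) auto
  have e_le: "e i \<le> e j \<longleftrightarrow> j \<le> i" if "i \<in> {1..q}" "j \<in> {1..q}" for i j
    using e_mono[of i j] e_mono[of j i] that by (cases i j rule: linorder_cases) auto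
  have inj: "inj_on e {1..q}"
    using e_le by (intro inj_onI) (metis order_antisym order_refl)
  have eX: "e ` {1..q} \<subseteq> X" using xs unfolding e_def by (auto simp flip: xs(1))
  define x0 x1 where "x0 = xs ! 0" and "x1 = xs ! 1"
  have low: "x0 < x1" "x0 \<in> X" "x1 \<in> X" using srt[of 0 1] xs unfolding x0_def x1_def by (auto simp flip: xs(1))
  have lowe: "x1 < e i" if "i \<in> {1..q}" for i
    unfolding x1_def e_def using that by (intro srt) auto
  have Xe: "X = insert x0 (insert x1 (e ` {1..q}))"
  proof
    show "X \<subseteq> insert x0 (insert x1 (e ` {1..q}))"
    proof
      fix x assume "x \<in> X"
      then obtain i where i: "i < q + 2" "x = xs ! i" using xs by (metis in_set_conv_nth)
      consider "i = 0" | "i = 1" | "2 \<le> i" by linarith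
      then show "x \<in> insert x0 (insert x1 (e ` {1..q}))"
      proof cases
        case 3
        then have "x = e (q + 2 - i)" "q + 2 - i \<in> {1..q}" using i by (auto simp: e_def)
        then show ?thesis by blast
      qed (use i in \<open>auto simp: x0_def x1_def\<close>)
    qed
  qed (use low eX in auto)
  have up: "e ` R \<inter> {e i..} = e ` (R \<inter> {..i})" if "R \<subseteq> {1..q}" "i \<in> {1..q}" for R i
    using that e_le by (auto simp: subset_iff)
  have card_e: "card (e ` R) = card R" if "R \<subseteq> {1..q}" for R
    using that inj by (meson card_image inj_on_subset)
  have compl: "(X - e ` R) \<inter> {e i..} = e ` ({1..q} - R) \<inter> {e i..}" if "R \<subseteq> {1..q}" "i \<in> {1..q}" for R i
  proof -
    have "X - e ` R \<subseteq> insert x0 (insert x1 (e ` {1..q} - e ` R))" unfolding Xe by blast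
    moreover have "e ` {1..q} - e ` R = e ` ({1..q} - R)"
      using inj that(1) by (simp add: inj_on_image_set_diff)
    moreover have "x0 \<notin> {e i..}" "x1 \<notin> {e i..}" using low lowe[OF that(2)] by auto
    moreover have "e ` ({1..q} - R) \<subseteq> X - e ` R" using calculation(2) eX by blast
    ultimately show ?thesis by blast
  qed
  have level: "card (e ` R \<inter> {e i..}) \<le> card ((X - e ` R) \<inter> {e i..}) \<longleftrightarrow>
      card (R \<inter> {..i}) \<le> card (({1..q} - R) \<inter> {..i})" if "R \<subseteq> {1..q}" "i \<in> {1..q}" for R i
  proof -
    have "card (e ` R \<inter> {e i..}) = card (R \<inter> {..i})"
      using up[OF that] card_e[of "R \<inter> {..i}"] that by auto
    moreover have "card ((X - e ` R) \<inter> {e i..}) = card (({1..q} - R) \<inter> {..i})"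
      using compl[OF that] up[of "{1..q} - R" i] card_e[of "({1..q} - R) \<inter> {..i}"] that by auto
    ultimately show ?thesis by simp
  qed
  have iff: "e ` R \<in> reverse_ballots X m \<longleftrightarrow> R \<in> ballot_sets q m" if R: "R \<subseteq> {1..q}" for R
  proof -
    have "(\<forall>z. card (e ` R \<inter> {z..}) \<le> card ((X - e ` R) \<inter> {z..})) \<longleftrightarrow>
        (\<forall>i\<in>{1..q}. card (R \<inter> {..i}) \<le> card (({1..q} - R) \<inter> {..i}))"
    proof (intro iffI ballI allI)
      fix i assume "\<forall>z. card (e ` R \<inter> {z..}) \<le> card ((X - e ` R) \<inter> {z..})" "i \<in> {1..q}"
      then show "card (R \<inter> {..i}) \<le> card (({1..q} - R) \<inter> {..i})" using level[OF R] by blast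
    next
      fix z assume *: "\<forall>i\<in>{1..q}. card (R \<inter> {..i}) \<le> card (({1..q} - R) \<inter> {..i})"
      define J where "J = {j \<in> R. z \<le> e j}"
      show "card (e ` R \<inter> {z..}) \<le> card ((X - e ` R) \<inter> {z..})"
      proof (cases "J = {}")
        case True
        then have "e ` R \<inter> {z..} = {}" by (auto simp: J_def)
        then show ?thesis by simp
      next
        case False
        have "finite R" using R finite_subset by blast
        then have fin: "finite J" by (simp add: J_def)
        define i where "i = Max J"
        have i: "i \<in> J" and imax: "\<And>j. j \<in> J \<Longrightarrow> j \<le> i" using Max_in[OF fin False] Max_ge[OF fin] by (auto simp: i_def)
        have iq: "i \<in> {1..q}" "z \<le> e i" using i R by (auto simp: J_def)
        have "e ` R \<inter> {z..} = e ` R \<inter> {e i..}"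
        proof -
          have "e i \<le> e j" if "j \<in> R" "z \<le> e j" for j
            using e_le[of i j] iq(1) R that imax[of j] by (auto simp: J_def)
          then show ?thesis using iq(2) by auto
        qed
        then have "card (e ` R \<inter> {z..}) \<le> card ((X - e ` R) \<inter> {e i..})"
          using level[OF R iq(1)] * iq(1) by simp
        also have "\<dots> \<le> card ((X - e ` R) \<inter> {z..})" using assms(1) iq(2) by (intro card_mono) auto
        finally show ?thesis .
      qed
    qed
    also have "\<dots> \<longleftrightarrow> (\<forall>z. card (R \<inter> {..z}) \<le> card (({1..q} - R) \<inter> {..z}))"
    proof (intro iffI allI ballI)
      fix z assume *: "\<forall>i\<in>{1..q}. card (R \<inter> {..i}) \<le> card (({1..q} - R) \<inter> {..i})"
      have eq: "S \<inter> {..z} = S \<inter> {..min z q}" if "S \<subseteq> {1..q}" for S using that by auto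
      show "card (R \<inter> {..z}) \<le> card (({1..q} - R) \<inter> {..z})"
      proof (cases "min z q = 0")
        case True
        then have "R \<inter> {..z} = {}" using R by force
        then show ?thesis by simp
      next
        case False
        then have "min z q \<in> {1..q}" by auto
        then have "card (R \<inter> {..min z q}) \<le> card (({1..q} - R) \<inter> {..min z q})" using * by blast
        then show ?thesis using eq[OF R] eq[of "{1..q} - R"] by simp
      qed
    qed blast
    finally have "(\<forall>z. card (e ` R \<inter> {z..}) \<le> card ((X - e ` R) \<inter> {z..})) \<longleftrightarrow>
      (\<forall>z. card (R \<inter> {..z}) \<le> card (({1..q} - R) \<inter> {..z}))" .
    moreover have "2 \<le> card ((X - e ` R) \<inter> {..<b})" if b: "b \<in> e ` R" for b
    proof -
      obtain i where i: "i \<in> {1..q}" "b = e i" using b R by blast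
      have "x1 < y" if "y \<in> e ` R" for y using that R lowe by blast
      then have "x0 \<notin> e ` R" "x1 \<notin> e ` R" using low(1) less_asym by blast+
      then have "{x0, x1} \<subseteq> (X - e ` R) \<inter> {..<b}" using low lowe[OF i(1)] i(2) by auto
      then have "card {x0, x1} \<le> card ((X - e ` R) \<inter> {..<b})" using assms(1) by (intro card_mono) auto
      then show ?thesis using low(1) by simp
    qed
    moreover have "e ` R \<subseteq> X" using R eX by blast
    ultimately show ?thesis using R card_e[OF R] unfolding reverse_ballots_def ballot_sets_def mem_Collect_eq by simp
  qed
  have sub: "reverse_ballots X m \<subseteq> (`) e ` Pow {1..q}"
  proof
    fix B assume B: "B \<in> reverse_ballots X m"
    then have BX: "B \<subseteq> X" and two: "\<And>b. b \<in> B \<Longrightarrow> 2 \<le> card ((X - B) \<inter> {..<b})"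
      by (auto simp: reverse_ballots_def)
    have "(X - B) \<inter> {..<b} \<subseteq> {x0}" if "b \<le> x1" for b
      using that lowe low(1) unfolding Xe by fastforce
    then have one: "card ((X - B) \<inter> {..<b}) \<le> 1" if "b \<le> x1" for b
      using that card_mono[of "{x0}" "(X - B) \<inter> {..<b}"] by simp
    have "x0 \<notin> B" using two[of x0] one[of x0] low(1) by auto
    moreover have "x1 \<notin> B" using two[of x1] one[of x1] by auto
    ultimately have "B \<subseteq> e ` {1..q}" using BX Xe by blast
    then show "B \<in> (`) e ` Pow {1..q}" by (metis PowI image_eqI subset_imageE)
  qed
  have "reverse_ballots X m = (`) e ` ballot_sets q m"
  proof (intro equalityI subsetI)
    fix B assume B: "B \<in> reverse_ballots X m"
    then obtain R where "R \<subseteq> {1..q}" "B = e ` R" using sub by blast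
    then show "B \<in> (`) e ` ballot_sets q m" using iff B by blast
  next
    fix B assume "B \<in> (`) e ` ballot_sets q m"
    then obtain R where R: "R \<in> ballot_sets q m" "B = e ` R" by blast
    then have "R \<subseteq> {1..q}" by (simp add: ballot_sets_def)
    then show "B \<in> reverse_ballots X m" using iff R by blast
  qed
  moreover have "inj_on ((`) e) (ballot_sets q m)"
    using inj by (intro inj_on_subset[OF inj_on_image_Pow]) (auto simp: ballot_sets_def)
  ultimately show ?thesis using card_image by metis
qed

text \<open>At level 0 the a's are an arbitrary \<open>s\<close>-subset, and for each choice the
  \<open>m + p + 2\<close> other positions carry a reverse ballot sequence.\<close>

lemma card_queues_zero:
  assumes "m \<le> p" and l: "l = s + m + p + 2"
  shows "card (queues 0 l s m) = (l choose s) * num_SYT [p, m]"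
proof -
  define \<A> where "\<A> = {A. A \<subseteq> {1..l} \<and> card A = s}"
  have fin: "finite \<A>" unfolding \<A>_def by simp
  have card\<A>: "card \<A> = (l choose s)" unfolding \<A>_def using n_subsets[of "{1..l}" s] by simp
  have rb: "card (reverse_ballots ({1..l} - A) m) = num_SYT [p, m]" if "A \<in> \<A>" for A
  proof -
    have "finite A" using that finite_subset unfolding \<A>_def by blast
    then have "card ({1..l} - A) = p + m + 2" using that l by (simp add: \<A>_def card_Diff_subset)
    then show ?thesis using card_reverse_ballots[of "{1..l} - A" "p + m" m] num_SYT_two_rows[OF assms(1)] by simp
  qed
  define f :: "nat set \<times> nat set \<Rightarrow> nat set \<times> nat set \<times> nat set"
    where "f = (\<lambda>(A, B). (A, B, {1..l} - A - B))"
  have "inj_on f (SIGMA A:\<A>. reverse_ballots ({1..l} - A) m)" by (auto simp: inj_on_def f_def)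
  moreover have "f ` (SIGMA A:\<A>. reverse_ballots ({1..l} - A) m) = queues 0 l s m"
  proof (intro equalityI subsetI)
    fix x assume "x \<in> f ` (SIGMA A:\<A>. reverse_ballots ({1..l} - A) m)"
    then obtain A B where x: "x = (A, B, {1..l} - A - B)" and A: "A \<in> \<A>"
      and B: "B \<in> reverse_ballots ({1..l} - A) m" by (auto simp: f_def)
    have arr: "arrangement l s m A B ({1..l} - A - B)"
      using A B unfolding \<A>_def reverse_ballots_def arrangement_def by blast
    note sub = arrangementD[OF arr]
    have "excess B ({1..l} - A - B) z \<le> 0" for z
      using B unfolding reverse_ballots_def excess_def by simp
    moreover have "excess B ({1..l} - A - B) (Suc l) = 0" using excess_eventually[OF sub(2,3)] by simp
    \<comment> \<open>Behind the last position the lead is constant, so the cut \<open>Suc l\<close>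
      is its own witness and imposes nothing on \<open>A\<close>.\<close>
    moreover have "covered A B (Suc l)"
      unfolding covered_def using lead_eventually[OF sub(1,2)] by (intro exI[of _ "Suc l"]) simp
    ultimately show "x \<in> queues 0 l s m" unfolding queues_def x using arr by blast
  next
    fix x assume "x \<in> queues 0 l s m"
    then obtain A B C where x: "x = (A, B, C)" and arr: "arrangement l s m A B C"
      and le: "\<forall>z. excess B C z \<le> 0" unfolding queues_def by blast
    have un: "A \<union> B \<union> C = {1..l}" using arr by (simp add: arrangement_def)
    note sub = arrangementD[OF arr]
    have C: "{1..l} - A - B = C" using un sub(7-9) by blast
    have "B \<subseteq> {1..l} - A" "A \<subseteq> {1..l}" using un sub(7) by blast+
    moreover have "\<forall>b\<in>B. 2 \<le> card (C \<inter> {..<b})" using arr by (simp add: arrangement_def)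
    moreover have "\<forall>z. card (B \<inter> {z..}) \<le> card (C \<inter> {z..})" using le by (simp add: excess_def)
    ultimately have "A \<in> \<A>" "B \<in> reverse_ballots ({1..l} - A) m"
      using sub(10,11) unfolding \<A>_def reverse_ballots_def mem_Collect_eq C by blast+
    moreover have "f (A, B) = x" by (simp only: f_def x C prod.case)
    ultimately show "x \<in> f ` (SIGMA A:\<A>. reverse_ballots ({1..l} - A) m)" by force
  qed
  ultimately have "card (queues 0 l s m) = card (SIGMA A:\<A>. reverse_ballots ({1..l} - A) m)"
    using card_image by metis
  also have "\<dots> = (\<Sum>A\<in>\<A>. card (reverse_ballots ({1..l} - A) m))"
    using fin by (intro card_SigmaI) (auto simp: reverse_ballots_def intro: finite_subset)
  also have "\<dots> = (l choose s) * num_SYT [p, m]" using rb card\<A> by simp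
  finally show ?thesis .
qed

theorem theorem5p4:
  fixes s t n N :: nat
  assumes "s \<ge> 1" and "t \<ge> 1" and "n > s + t" and "N = n + 2 * s + t"
  shows "beta13 s t n = binom (N - 1) (int s - 2) * num_SYT [n - 1, s + t]"
proof -
  have beta: "beta13 s t n = card (queues 2 (N - 1) s (s + t))"
    using beta13_eq_card_queues assms by simp
  show ?thesis
  proof (cases "s = 1")
    case True
    \<comment> \<open>The only a is consumed by the first step, at level 1; the binomial has lower
      index -1.\<close>
    then have "card (queues 2 (N - 1) s (s + t)) = card (queues 1 (N - 1) 0 (s + t))"
      using card_queues_step[of 2 0 "s + t" "N - 1"] assms(2) by simp
    then show ?thesis using beta queues_0_empty[of 1] True by (simp add: binom_def)
  next
    case False
    then obtain r where r: "s = Suc (Suc r)" using assms(1) by (metis One_nat_def not0_implies_Suc not_one_le_zero)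
    have "card (queues 2 (N - 1) s (s + t)) = card (queues 1 (N - 1) (Suc r) (s + t))"
      using card_queues_step[of 2 "Suc r" "s + t" "N - 1"] assms(2) r by simp
    also have "\<dots> = card (queues 0 (N - 1) r (s + t))"
      using card_queues_step[of 1 r "s + t" "N - 1"] assms(2) r by simp
    \<comment> \<open>The lengths fit: \<open>N - 1 = r + (s + t) + (n - 1) + 2\<close> for
      \<open>s = r + 2\<close>.\<close>
    also have "\<dots> = ((N - 1) choose r) * num_SYT [n - 1, s + t]"
      using assms r by (intro card_queues_zero) auto
    finally show ?thesis using beta r by (simp add: binom_def)
  qed
qed

end
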